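(* Let $g$ be the Kerr-(anti-)de Sitter metric with real parameters $a,m,\Lambda$ (see context). On the symmetry axis $\theta=0$ the invariant $I_6=l_\mu l^\mu$, $l_\mu=-\nabla_\mu(C^*_{\alpha\beta\gamma\delta}C^{\alpha\beta\gamma\delta})$, equals $$I_6=-\frac{27648\,m^4\left(a^6-21a^4r^2+35a^2r^4-7r^6\right)^2\left(\Lambda r^4+(\Lambda a^2-3)r^2+6mr-3a^2\right)a^2}{(a^2+r^2)^{15}}.$$ In this case $I_6$ vanishes at the horizon radii (the real roots of $\Delta_r$) of the Kerr black hole with cosmological constant and also, for $a>0$, at the three positive real roots of the sextic polynomial $a^6-21a^4r^2+35a^2r^4-7r^6$ in $r$, which are $$r\simeq0.22824347439\,a,\qquad r\simeq0.79747338888\,a,\qquad r\simeq2.0765213965\,a.$$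
   Context: Kerr-(anti-)de Sitter metric: in coordinates $(t,r,\theta,\phi)$, signature $(-,+,+,+)$, $$ds^2=-\frac{\Delta_r}{\Xi^2\rho^2}(dt-a\sin^2\theta\,d\phi)^2+\frac{\rho^2}{\Delta_r}dr^2+\frac{\rho^2}{\Delta_\theta}d\theta^2+\frac{\Delta_\theta\sin^2\theta}{\Xi^2\rho^2}\big(a\,dt-(r^2+a^2)d\phi\big)^2,$$ $\Delta_\theta=1+\frac{a^2\Lambda}{3}\cos^2\theta$, $\Xi=1+\frac{a^2\Lambda}{3}\neq0$, $\Delta_r=(1-\frac{\Lambda}{3}r^2)(r^2+a^2)-2mr$, $\rho^2=r^2+a^2\cos^2\theta$. $C_{\alpha\beta\gamma\delta}$ is the Weyl tensor of $g$, and $C^*_{\alpha\beta\gamma\delta}=\frac12E_{\alpha\beta\kappa\lambda}C^{\kappa\lambda}{}_{\gamma\delta}$ with $E$ the Levi-Civita pseudotensor ($I_6$ does not depend on the orientation). $I_6$ is a rational function of $(r,\cos\theta)$ with denominator a power of $\rho^2$; its value on the axis and at points with $\Delta_r=0$ is obtained by continuity. The symbol $\simeq$ denotes decimal approximation. *)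

theory Defs
  imports "HOL-Analysis.Analysis"
begin

section \<open>Curvature of a metric in a four-dimensional coordinate chart\<close>

type_synonym metric = "real^4 \<Rightarrow> real^4^4"

definition partial :: "4 \<Rightarrow> (real^4 \<Rightarrow> real) \<Rightarrow> real^4 \<Rightarrow> real" where
  "partial i f x = deriv (\<lambda>s. f (\<chi> j. if j = i then s else x $ j)) (x $ i)"

definition inverse_metric :: "metric \<Rightarrow> metric" where
  "inverse_metric g x = matrix_inv (g x)"

text \<open>\<open>christoffel g k i j\<close> is the symbol with upper index \<open>k\<close>.\<close>

definition christoffel :: "metric \<Rightarrow> 4 \<Rightarrow> 4 \<Rightarrow> 4 \<Rightarrow> real^4 \<Rightarrow> real" where
  "christoffel g k i j x =
     (1/2) * (\<Sum>l\<in>UNIV. inverse_metric g x $ k $ l *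
       (partial i (\<lambda>y. g y $ l $ j) x + partial j (\<lambda>y. g y $ i $ l) x
        - partial l (\<lambda>y. g y $ i $ j) x))"

text \<open>\<open>riemann_up g a b c d\<close> has \<open>a\<close> raised:
  \<open>R\<^sup>a\<^bsub>bcd\<^esub> = \<partial>\<^sub>c \<Gamma>\<^sup>a\<^bsub>db\<^esub> - \<partial>\<^sub>d \<Gamma>\<^sup>a\<^bsub>cb\<^esub> + \<dots>\<close>.\<close>

definition riemann_up :: "metric \<Rightarrow> 4 \<Rightarrow> 4 \<Rightarrow> 4 \<Rightarrow> 4 \<Rightarrow> real^4 \<Rightarrow> real" where
  "riemann_up g a b c d x =
     partial c (christoffel g a d b) x - partial d (christoffel g a c b) x
     + (\<Sum>e\<in>UNIV. christoffel g a c e x * christoffel g e d b x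
                 - christoffel g a d e x * christoffel g e c b x)"

definition riemann :: "metric \<Rightarrow> 4 \<Rightarrow> 4 \<Rightarrow> 4 \<Rightarrow> 4 \<Rightarrow> real^4 \<Rightarrow> real" where
  "riemann g a b c d x = (\<Sum>e\<in>UNIV. g x $ a $ e * riemann_up g e b c d x)"

definition ricci :: "metric \<Rightarrow> 4 \<Rightarrow> 4 \<Rightarrow> real^4 \<Rightarrow> real" where
  "ricci g b d x = (\<Sum>a\<in>UNIV. riemann_up g a b a d x)"

definition scalar_curvature :: "metric \<Rightarrow> real^4 \<Rightarrow> real" where
  "scalar_curvature g x = (\<Sum>b\<in>UNIV. \<Sum>d\<in>UNIV. inverse_metric g x $ b $ d * ricci g b d x)"

text \<open>The coefficients \<open>1/2\<close> and \<open>1/6\<close> are \<open>1/(n-2)\<close> and \<open>1/((n-1)(n-2))\<close> for \<open>n = 4\<close>.\<close>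

definition weyl :: "metric \<Rightarrow> 4 \<Rightarrow> 4 \<Rightarrow> 4 \<Rightarrow> 4 \<Rightarrow> real^4 \<Rightarrow> real" where
  "weyl g a b c d x =
     riemann g a b c d x
     - (1/2) * (g x $ a $ c * ricci g b d x - g x $ a $ d * ricci g b c x
              - g x $ b $ c * ricci g a d x + g x $ b $ d * ricci g a c x)
     + (1/6) * scalar_curvature g x * (g x $ a $ c * g x $ b $ d - g x $ a $ d * g x $ b $ c)"

text \<open>The first pair of indices raised, and all four indices raised.\<close>

definition weyl_up2 :: "metric \<Rightarrow> 4 \<Rightarrow> 4 \<Rightarrow> 4 \<Rightarrow> 4 \<Rightarrow> real^4 \<Rightarrow> real" where
  "weyl_up2 g a b c d x =
     (\<Sum>p\<in>UNIV. \<Sum>q\<in>UNIV. inverse_metric g x $ a $ p * inverse_metric g x $ b $ q * weyl g p q c d x)"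

definition weyl_up4 :: "metric \<Rightarrow> 4 \<Rightarrow> 4 \<Rightarrow> 4 \<Rightarrow> 4 \<Rightarrow> real^4 \<Rightarrow> real" where
  "weyl_up4 g a b c d x =
     (\<Sum>p\<in>UNIV. \<Sum>q\<in>UNIV. inverse_metric g x $ c $ p * inverse_metric g x $ d $ q * weyl_up2 g a b p q x)"

definition levi_civita_symbol :: "4 \<Rightarrow> 4 \<Rightarrow> 4 \<Rightarrow> 4 \<Rightarrow> real" where
  "levi_civita_symbol a b c d =
     (let p = (\<lambda>n::4. (vector [a, b, c, d] :: 4^4) $ n)
      in if bij p then of_int (sign p) else 0)"

definition levi_civita :: "metric \<Rightarrow> 4 \<Rightarrow> 4 \<Rightarrow> 4 \<Rightarrow> 4 \<Rightarrow> real^4 \<Rightarrow> real" where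
  "levi_civita g a b c d x = sqrt \<bar>det (g x)\<bar> * levi_civita_symbol a b c d"

definition dual_weyl :: "metric \<Rightarrow> 4 \<Rightarrow> 4 \<Rightarrow> 4 \<Rightarrow> 4 \<Rightarrow> real^4 \<Rightarrow> real" where
  "dual_weyl g a b c d x =
     (1/2) * (\<Sum>k\<in>UNIV. \<Sum>l\<in>UNIV. levi_civita g a b k l x * weyl_up2 g k l c d x)"

definition dual_weyl_contraction :: "metric \<Rightarrow> real^4 \<Rightarrow> real" where
  "dual_weyl_contraction g x =
     (\<Sum>a\<in>UNIV. \<Sum>b\<in>UNIV. \<Sum>c\<in>UNIV. \<Sum>d\<in>UNIV. dual_weyl g a b c d x * weyl_up4 g a b c d x)"

text \<open>The covariant derivative of a scalar is its partial derivative.\<close>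

definition covector_l :: "metric \<Rightarrow> 4 \<Rightarrow> real^4 \<Rightarrow> real" where
  "covector_l g \<mu> x = - partial \<mu> (dual_weyl_contraction g) x"

definition I6 :: "metric \<Rightarrow> real^4 \<Rightarrow> real" where
  "I6 g x = (\<Sum>\<mu>\<in>UNIV. \<Sum>\<nu>\<in>UNIV. inverse_metric g x $ \<mu> $ \<nu> * covector_l g \<mu> x * covector_l g \<nu> x)"


section \<open>The Kerr-(anti-)de Sitter metric\<close>

definition Delta_theta :: "real \<Rightarrow> real \<Rightarrow> real \<Rightarrow> real" where
  "Delta_theta a \<Lambda> \<theta> = 1 + a\<^sup>2 * \<Lambda> / 3 * (cos \<theta>)\<^sup>2"

definition Xi :: "real \<Rightarrow> real \<Rightarrow> real" where
  "Xi a \<Lambda> = 1 + a\<^sup>2 * \<Lambda> / 3"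

definition Delta_r :: "real \<Rightarrow> real \<Rightarrow> real \<Rightarrow> real \<Rightarrow> real" where
  "Delta_r a m \<Lambda> r = (1 - \<Lambda> / 3 * r\<^sup>2) * (r\<^sup>2 + a\<^sup>2) - 2 * m * r"

definition rho_sq :: "real \<Rightarrow> real \<Rightarrow> real \<Rightarrow> real" where
  "rho_sq a r \<theta> = r\<^sup>2 + a\<^sup>2 * (cos \<theta>)\<^sup>2"

text \<open>A point is \<open>x = vector [t, r, \<theta>, \<phi>]\<close>. The two vectors below hold the components of
  \<open>dt - a sin\<^sup>2 \<theta> d\<phi>\<close> and \<open>a dt - (r\<^sup>2 + a\<^sup>2) d\<phi>\<close>.\<close>

definition form_t :: "real \<Rightarrow> real^4 \<Rightarrow> real^4" where
  "form_t a x = vector [1, 0, 0, - a * (sin (x $ 3))\<^sup>2]"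

definition form_phi :: "real \<Rightarrow> real^4 \<Rightarrow> real^4" where
  "form_phi a x = vector [a, 0, 0, - ((x $ 2)\<^sup>2 + a\<^sup>2)]"

definition kerr_ads :: "real \<Rightarrow> real \<Rightarrow> real \<Rightarrow> metric" where
  "kerr_ads a m \<Lambda> x =
     (let r = x $ 2; \<theta> = x $ 3;
          dr = axis 2 1 :: real^4; d\<theta> = axis 3 1 :: real^4
      in \<chi> i j.
        - Delta_r a m \<Lambda> r / ((Xi a \<Lambda>)\<^sup>2 * rho_sq a r \<theta>) * (form_t a x $ i * form_t a x $ j)
        + rho_sq a r \<theta> / Delta_r a m \<Lambda> r * (dr $ i * dr $ j)
        + rho_sq a r \<theta> / Delta_theta a \<Lambda> \<theta> * (d\<theta> $ i * d\<theta> $ j)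
        + Delta_theta a \<Lambda> \<theta> * (sin \<theta>)\<^sup>2 / ((Xi a \<Lambda>)\<^sup>2 * rho_sq a r \<theta>)
            * (form_phi a x $ i * form_phi a x $ j))"

text \<open>The points at which the coordinate expression of the metric is smooth and non-degenerate;
  the axis and the roots of \<open>Delta_r\<close> lie outside.\<close>

definition regular_points :: "real \<Rightarrow> real \<Rightarrow> real \<Rightarrow> (real^4) set" where
  "regular_points a m \<Lambda> =
     {x. sin (x $ 3) \<noteq> 0 \<and> Delta_r a m \<Lambda> (x $ 2) \<noteq> 0 \<and>
         Delta_theta a \<Lambda> (x $ 3) \<noteq> 0 \<and> rho_sq a (x $ 2) (x $ 3) \<noteq> 0}"

text \<open>\<open>f\<close>, considered on \<open>D\<close>, has the value \<open>v\<close> at \<open>x\<close> by continuity. The first conjunct makes \<open>v\<close>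
  unique.\<close>

definition value_by_continuity ::
    "('a::t2_space \<Rightarrow> 'b::t2_space) \<Rightarrow> 'a set \<Rightarrow> 'a \<Rightarrow> 'b \<Rightarrow> bool" where
  "value_by_continuity f D x v \<longleftrightarrow> x islimpt D \<and> (f \<longlongrightarrow> v) (at x within D)"

definition I6_axis_value :: "real \<Rightarrow> real \<Rightarrow> real \<Rightarrow> real \<Rightarrow> real \<Rightarrow> bool" where
  "I6_axis_value a m \<Lambda> r v \<longleftrightarrow>
     (\<forall>t \<phi>. value_by_continuity (I6 (kerr_ads a m \<Lambda>)) (regular_points a m \<Lambda>) (vector [t, r, 0, \<phi>]) v)"

end

theory Submission
  imports Defs
begin

text \<open>In Carter's coframe \<open>e\<^sup>1 = (dt - a sin\<^sup>2 \<theta> d\<phi>) / \<Xi>\<close>, \<open>e\<^sup>2 = (\<rho>\<^sup>2 / X) dr\<close>,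
  \<open>e\<^sup>3 = (\<rho>\<^sup>2 / Y) du\<close>, \<open>e\<^sup>4 = (a dt - (r\<^sup>2 + a\<^sup>2) d\<phi>) / \<Xi>\<close> with \<open>u = cos \<theta>\<close>, \<open>X = \<Delta>\<^sub>r\<close> and
  \<open>Y = \<Delta>\<^sub>\<theta> sin\<^sup>2 \<theta>\<close>, the metric is \<open>diag (- X, X, Y, Y) / \<rho>\<^sup>2\<close> and all connection coefficients
  are polynomials in \<open>r, u\<close> divided by \<open>\<rho>\<^sup>4\<close>. Multiplied by \<open>\<rho>\<^sup>8\<close>, the curvature becomes polynomial: the
  metric is Einstein with a type D Weyl tensor built from \<open>P + \<i> Q = m (r + \<i> a u)\<^sup>3\<close>. The contraction of the
  Weyl tensor with its dual is invariant under change of frame up to orientation, hence equals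
  \<open>\<plusminus> 96 P Q / \<rho>\<^sup>12 = \<plusminus> 48 m\<^sup>2 Im (r - \<i> a u)\<^sup>-\<^sup>6\<close>, whose \<open>r\<close>-derivative on the axis gives the result.
  The \<open>\<theta>\<close>-derivative carries a factor \<open>sin \<theta>\<close> and disappears in the limit.\<close>

section \<open>Partial derivatives along coordinates\<close>

text \<open>The coframe is deliberately not orthonormal. Normalising it would bring in square roots
  of \<open>X\<close> and \<open>Y\<close>, whose signs depend on the region: \<open>X\<close>
  changes sign at simple horizons and \<open>Y\<close> has the sign of \<open>Delta_theta\<close>.
  With a frame metric that is diagonal but variable, one computation covers all regular points and
  every frame component is rational in \<open>r\<close> and \<open>u\<close>. The price is that the
  connection matrices are not skew and that metric compatibility contains derivatives of the frame
  metric. The definitions consist of iterated coordinate derivatives and deeply nested sums; a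
  locale bridges the gap to this small algebra. A connection is supplied by formula,
  torsion-freeness and compatibility identify it with the Christoffel symbols, and the curvature is
  then computed from the connection matrices alone. The volume factor, a square root of an absolute
  value, carries no orientation, so the contraction acquires the factor
  \<open>sgn (sin \<theta>)\<close>; it is locally constant and squares away in \<open>I6\<close>.
  Axis and horizons are handled by a single limit, because the resulting formula is continuous at
  axis points with nonzero \<open>r^2 + a^2\<close>.\<close>

definition has_partial :: "4 \<Rightarrow> (real^4 \<Rightarrow> real) \<Rightarrow> real \<Rightarrow> real^4 \<Rightarrow> bool" where
  "has_partial i f D x \<longleftrightarrow>
     ((\<lambda>s. f (\<chi> j. if j = i then s else x $ j)) has_real_derivative D) (at (x $ i))"

lemma upd_self: "(\<chi> j. if j = i then x $ i else x $ j) = (x :: real^4)"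
  by (simp add: vec_eq_iff)

text \<open>\<open>deriv\<close> returns a value even where no derivative exists. All rules are
  therefore proved for the relation \<open>has_partial\<close>, which includes differentiability,
  and are transferred to \<open>partial\<close> only through this lemma.\<close>

lemma partial_eq: "has_partial i f D x \<Longrightarrow> partial i f x = D"
  unfolding has_partial_def partial_def by (rule DERIV_imp_deriv)

lemma has_partial_const: "has_partial i (\<lambda>x. c) 0 x"
  by (simp add: has_partial_def)

lemma has_partial_add:
  "has_partial i f D x \<Longrightarrow> has_partial i g E x \<Longrightarrow> has_partial i (\<lambda>x. f x + g x) (D + E) x"
  unfolding has_partial_def by (rule DERIV_add)

lemma has_partial_mult:
  "has_partial i f D x \<Longrightarrow> has_partial i g E x \<Longrightarrow> has_partial i (\<lambda>x. f x * g x) (D * g x + f x * E) x"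
  unfolding has_partial_def by (auto intro!: derivative_eq_intros simp: upd_self)

lemma has_partial_sum:
  "(\<And>k. k \<in> A \<Longrightarrow> has_partial i (f k) (D k) x) \<Longrightarrow>
     has_partial i (\<lambda>x. \<Sum>k\<in>A. f k x) (\<Sum>k\<in>A. D k) x"
  unfolding has_partial_def by (rule DERIV_sum)

lemma tendsto_upd: "((\<lambda>s. \<chi> j. if j = i then s else x $ j) \<longlongrightarrow> (x :: real^4)) (at (x $ i))"
proof (rule vec_tendstoI)
  fix j show "((\<lambda>s. (\<chi> j. if j = i then s else x $ j) $ j) \<longlongrightarrow> x $ j) (at (x $ i))"
    by (cases "j = i") auto
qed

lemma eventually_upd:
  fixes U :: "(real^4) set"
  assumes "open U" "x \<in> U"
  shows "eventually (\<lambda>s. (\<chi> j. if j = i then s else x $ j) \<in> U) (nhds (x $ i))"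
  using topological_tendstoD[OF tendsto_upd[where i = i and x = x] assms] assms(2)
  by (auto simp: eventually_at_filter upd_self elim: eventually_mono)

lemma has_partial_cong:
  assumes "open U" "x \<in> U" "\<And>y. y \<in> U \<Longrightarrow> f y = g y"
  shows "has_partial i f D x \<longleftrightarrow> has_partial i g D x"
  unfolding has_partial_def
  by (rule DERIV_cong_ev) (use eventually_upd[OF assms(1,2), of i] assms(3) in \<open>auto elim: eventually_mono\<close>)

text \<open>Differentiation is local, so closed formulas valid only on an open set, such as those
  for Christoffel symbols and for the contraction, may replace the defined quantities under
  \<open>partial\<close>.\<close>

lemma partial_cong:
  assumes "open U" "x \<in> U" "\<And>y. y \<in> U \<Longrightarrow> f y = g y"
  shows "partial i f x = partial i g x"
  unfolding partial_def
  by (rule deriv_cong_ev) (use eventually_upd[OF assms(1,2), of i] assms(3) in \<open>auto elim: eventually_mono\<close>)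

section \<open>Entrywise derivatives of matrix functions and gauge covariance\<close>

definition has_mat_partial :: "4 \<Rightarrow> (real^4 \<Rightarrow> real^4^4) \<Rightarrow> real^4^4 \<Rightarrow> real^4 \<Rightarrow> bool" where
  "has_mat_partial i M D x \<longleftrightarrow> (\<forall>a b. has_partial i (\<lambda>y. M y $ a $ b) (D $ a $ b) x)"

lemma has_mat_partial_add:
  "has_mat_partial i M D x \<Longrightarrow> has_mat_partial i N E x \<Longrightarrow> has_mat_partial i (\<lambda>x. M x + N x) (D + E) x"
  by (simp add: has_mat_partial_def has_partial_add)

lemma has_mat_partial_mult:
  "has_mat_partial i M D x \<Longrightarrow> has_mat_partial i N E x \<Longrightarrow>
     has_mat_partial i (\<lambda>x. M x ** N x) (D ** N x + M x ** E) x"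
  by (auto simp: has_mat_partial_def matrix_matrix_mult_def simp flip: sum.distrib
      intro!: has_partial_sum has_partial_mult)

lemma has_partial_unique: "has_partial i f D x \<Longrightarrow> has_partial i f E x \<Longrightarrow> D = E"
  unfolding has_partial_def by (rule DERIV_unique)

lemma has_mat_partial_unique: "has_mat_partial i f D x \<Longrightarrow> has_mat_partial i f E x \<Longrightarrow> D = E"
  unfolding has_mat_partial_def vec_eq_iff by (metis has_partial_unique)

lemma has_mat_partial_const: "has_mat_partial i (\<lambda>x. c) 0 x"
  by (simp add: has_mat_partial_def has_partial_const)

lemma has_mat_partial_cong:
  assumes "open U" "x \<in> U" "\<And>y. y \<in> U \<Longrightarrow> M y = N y"
  shows "has_mat_partial i M D x \<longleftrightarrow> has_mat_partial i N D x"
  unfolding has_mat_partial_def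
  by (intro iff_allI has_partial_cong[OF assms(1,2)]) (simp add: assms(3))

lemma matrix_mult_diff_left: "(A - B) ** C = A ** C - B ** (C :: real^4^4)"
  and matrix_mult_diff_right: "C ** (A - B) = C ** A - C ** (B :: real^4^4)"
  and matrix_mult_add_left: "(A + B) ** C = A ** C + B ** C"
  and matrix_mult_minus_left: "(- A) ** C = - (A ** C)"
  and matrix_mult_minus_right: "C ** (- A) = - (C ** A)"
  by (simp_all add: matrix_matrix_mult_def vec_eq_iff sum_subtractf algebra_simps sum_negf sum.distrib)

text \<open>Differentiate \<open>F ** E = mat 1\<close> and multiply by \<open>F\<close> from the
  right. In applications the derivative of the frame only has to exist; its value follows from that
  of the coframe.\<close>

lemma inverse_frame_partial:
  assumes U: "open U" "x \<in> U" and FE: "\<And>y. y \<in> U \<Longrightarrow> F y ** E y = mat 1"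
    and F: "has_mat_partial i F dF x" and E: "has_mat_partial i E dE x"
  shows "dF = - (F x ** dE ** F x)"
proof -
  have "has_mat_partial i (\<lambda>y. F y ** E y) 0 x"
    using has_mat_partial_const[of i "mat 1" x]
      has_mat_partial_cong[of U x "\<lambda>y. F y ** E y" "\<lambda>y. mat 1" i 0] U FE by blast
  then have "dF ** E x + F x ** dE = 0"
    using has_mat_partial_unique[OF has_mat_partial_mult[OF F E]] by blast
  then have "(dF ** E x + F x ** dE) ** F x = 0"
    by (simp add: matrix_matrix_mult_def vec_eq_iff)
  moreover have "E x ** F x = mat 1"
    using FE[OF U(2)] by (simp add: matrix_left_right_inverse)
  ultimately have "dF + F x ** dE ** F x = 0"
    by (simp add: matrix_mult_add_left flip: matrix_mul_assoc)
  then show ?thesis by (simp add: eq_neg_iff_add_eq_0)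
qed

text \<open>Gauge covariance of the curvature: \<open>F (d + \<omega>) e\<close> has curvature \<open>F (d\<omega> + \<omega> \<and> \<omega>) e\<close>.\<close>

lemma gauge_curvature:
  fixes F e :: "real^4^4"
  assumes FE: "F ** e = mat 1"
  defines "G \<equiv> \<lambda>d w. F ** (d + w ** e)"
  shows "(- (F ** ec ** F)) ** (ed + wd ** e) + F ** (ecd + (wcd ** e + wd ** ec))
       - ((- (F ** ed ** F)) ** (ec + wc ** e) + F ** (ecd + (wdc ** e + wc ** ed)))
       + (G ec wc ** G ed wd - G ed wd ** G ec wc)
     = F ** (wcd - wdc + (wc ** wd - wd ** wc)) ** e"
proof -
  have EF: "e ** F = mat 1" using FE by (simp add: matrix_left_right_inverse)
  have c: "Z ** e ** F = Z" for Z :: "real^4^4"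
    by (simp add: EF flip: matrix_mul_assoc)
  note expand = matrix_mult_diff_left matrix_mult_diff_right matrix_mult_minus_left
      matrix_mult_minus_right matrix_add_ldistrib matrix_mult_add_left matrix_mul_assoc c
  show ?thesis
    unfolding G_def by (simp only: expand) (simp add: algebra_simps)
qed

section \<open>The Levi-Civita symbol and changes of frame\<close>

lemma det_4:
  "det (M :: real^4^4) =
     M$1$1 * (M$2$2 * (M$3$3 * M$4$4 - M$3$4 * M$4$3) - M$2$3 * (M$3$2 * M$4$4 - M$3$4 * M$4$2) + M$2$4 * (M$3$2 * M$4$3 - M$3$3 * M$4$2))
   - M$1$2 * (M$2$1 * (M$3$3 * M$4$4 - M$3$4 * M$4$3) - M$2$3 * (M$3$1 * M$4$4 - M$3$4 * M$4$1) + M$2$4 * (M$3$1 * M$4$3 - M$3$3 * M$4$1))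
   + M$1$3 * (M$2$1 * (M$3$2 * M$4$4 - M$3$4 * M$4$2) - M$2$2 * (M$3$1 * M$4$4 - M$3$4 * M$4$1) + M$2$4 * (M$3$1 * M$4$2 - M$3$2 * M$4$1))
   - M$1$4 * (M$2$1 * (M$3$2 * M$4$3 - M$3$3 * M$4$2) - M$2$2 * (M$3$1 * M$4$3 - M$3$3 * M$4$1) + M$2$3 * (M$3$1 * M$4$2 - M$3$2 * M$4$1))"
proof -
  have f234: "finite {2::4, 3, 4}" "1 \<notin> {2::4, 3, 4}" by auto
  have f34: "finite {3::4, 4}" "2 \<notin> {3::4, 4}" by auto
  have f4: "finite {4::4}" "3 \<notin> {4::4}" by auto
  show ?thesis
    unfolding det_def UNIV_4
    unfolding sum_over_permutations_insert[OF f234]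
    unfolding sum_over_permutations_insert[OF f34]
    unfolding sum_over_permutations_insert[OF f4]
    unfolding permutes_sing
    by (simp add: sign_swap_id permutation_swap_id permutation_compose sign_compose sign_id
        swap_id_eq) (simp add: algebra_simps)
qed

lemma vector_4:
  "(vector [x, y, z, w] :: 'a::zero^4) $ 1 = x" "(vector [x, y, z, w] :: 'a::zero^4) $ 2 = y"
  "(vector [x, y, z, w] :: 'a::zero^4) $ 3 = z" "(vector [x, y, z, w] :: 'a::zero^4) $ 4 = w"
  unfolding vector_def by simp_all

text \<open>The determinant is alternating in its rows: a bijective choice of rows contributes its
  sign, any other choice repeats a row. With unit vectors this evaluates the symbol, with the
  columns of a frame it gives the transformation law.\<close>

lemma det_selected_rows:
  fixes v :: "4 \<Rightarrow> real^4"
  shows "det (vector [v a, v b, v c, v d] :: real^4^4) = levi_civita_symbol a b c d * det (\<chi> i. v i)"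
proof -
  define p where "p = (\<lambda>n::4. (vector [a, b, c, d] :: 4^4) $ n)"
  have rows: "(vector [v a, v b, v c, v d] :: real^4^4) = (\<chi> i. (\<chi> i. v i) $ p i)"
    by (simp add: vec_eq_iff forall_4 p_def vector_4)
  show ?thesis
  proof (cases "bij p")
    case True
    then have "p permutes UNIV" by (intro bij_imp_permutes) auto
    from det_permute_rows[OF this, of "\<chi> i. v i"] show ?thesis
      unfolding rows using True by (simp add: levi_civita_symbol_def flip: p_def)
  next
    case False
    then obtain i j where "i \<noteq> j" "p i = p j"
      by (metis bij_betw_def finite_UNIV_inj_surj finite injI)
    then have "det (vector [v a, v b, v c, v d] :: real^4^4) = 0"
      unfolding rows by (intro det_identical_rows[of i j]) (auto simp: row_def)
    then show ?thesis
      using False by (simp add: levi_civita_symbol_def flip: p_def)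
  qed
qed

text \<open>Signs of permutations are awkward to evaluate directly; as determinants of unit vectors
  they become computable by \<open>det_4\<close>.\<close>

lemma levi_civita_symbol_det:
  "levi_civita_symbol a b c d = det (vector [axis a 1, axis b 1, axis c 1, axis d 1] :: real^4^4)"
proof -
  have "(\<chi> i. axis i 1) = (mat 1 :: real^4^4)"
    by (simp add: vec_eq_iff mat_def axis_def)
  then show ?thesis
    using det_selected_rows[of "\<lambda>i. axis i 1" a b c d] by simp
qed

lemma levi_civita_symbol_repeated:
  "levi_civita_symbol a a c d = 0" "levi_civita_symbol a b a d = 0" "levi_civita_symbol a b c a = 0"
  "levi_civita_symbol a b b d = 0" "levi_civita_symbol a b c b = 0" "levi_civita_symbol a b c c = 0"
  unfolding levi_civita_symbol_det by (simp_all add: det_4 vector_4 algebra_simps)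

lemma levi_civita_symbol_values:
  "levi_civita_symbol 1 2 3 4 = 1" "levi_civita_symbol 1 2 4 3 = - 1"
  "levi_civita_symbol 1 3 2 4 = - 1" "levi_civita_symbol 1 3 4 2 = 1"
  "levi_civita_symbol 1 4 2 3 = 1" "levi_civita_symbol 1 4 3 2 = - 1"
  "levi_civita_symbol 2 1 3 4 = - 1" "levi_civita_symbol 2 1 4 3 = 1"
  "levi_civita_symbol 2 3 1 4 = 1" "levi_civita_symbol 2 3 4 1 = - 1"
  "levi_civita_symbol 2 4 1 3 = - 1" "levi_civita_symbol 2 4 3 1 = 1"
  "levi_civita_symbol 3 1 2 4 = 1" "levi_civita_symbol 3 1 4 2 = - 1"
  "levi_civita_symbol 3 2 1 4 = - 1" "levi_civita_symbol 3 2 4 1 = 1"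
  "levi_civita_symbol 3 4 1 2 = 1" "levi_civita_symbol 3 4 2 1 = - 1"
  "levi_civita_symbol 4 1 2 3 = - 1" "levi_civita_symbol 4 1 3 2 = 1"
  "levi_civita_symbol 4 2 1 3 = 1" "levi_civita_symbol 4 2 3 1 = - 1"
  "levi_civita_symbol 4 3 1 2 = - 1" "levi_civita_symbol 4 3 2 1 = 1"
  by (simp_all add: levi_civita_symbol_det det_4 vector_4 axis_def)

lemma levi_civita_sum:
  "(\<Sum>a\<in>UNIV. \<Sum>b\<in>UNIV. \<Sum>c\<in>UNIV. \<Sum>d\<in>UNIV. levi_civita_symbol a b c d * X a b c d) =
     X 1 2 3 4 - X 1 2 4 3 - X 1 3 2 4 + X 1 3 4 2 + X 1 4 2 3 - X 1 4 3 2
   - X 2 1 3 4 + X 2 1 4 3 + X 2 3 1 4 - X 2 3 4 1 - X 2 4 1 3 + X 2 4 3 1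
   + X 3 1 2 4 - X 3 1 4 2 - X 3 2 1 4 + X 3 2 4 1 + X 3 4 1 2 - X 3 4 2 1
   - X 4 1 2 3 + X 4 1 3 2 + X 4 2 1 3 - X 4 2 3 1 - X 4 3 1 2 + X 4 3 2 1"
  by (simp only: sum_4 levi_civita_symbol_values levi_civita_symbol_repeated mult_zero_left
      mult_1_left mult_minus_left add_0_left add_0_right diff_conv_add_uminus)

lemma levi_civita_sum_prod:
  "(\<Sum>a\<in>UNIV. \<Sum>b\<in>UNIV. \<Sum>c\<in>UNIV. \<Sum>d\<in>UNIV.
      levi_civita_symbol a b c d * (t $ a * (u $ b * (v $ c * w $ d))))
   = det (vector [t, u, v, w] :: real^4^4)"
  unfolding levi_civita_sum by (simp add: det_4 vector_4 algebra_simps)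

text \<open>Each slot has its own matrix, so that mixed variance (frame for upper, coframe for lower
  indices) is covered; \<open>'i\<close> indexes coordinates, \<open>'j\<close> frame components.
  The nested form lets a contraction act on the matrix of one slot alone.\<close>

definition tensor_transform ::
    "('i \<Rightarrow> 'j::finite \<Rightarrow> real) \<Rightarrow> ('i \<Rightarrow> 'j \<Rightarrow> real) \<Rightarrow> ('i \<Rightarrow> 'j \<Rightarrow> real) \<Rightarrow> ('i \<Rightarrow> 'j \<Rightarrow> real)
      \<Rightarrow> ('j \<Rightarrow> 'j \<Rightarrow> 'j \<Rightarrow> 'j \<Rightarrow> real) \<Rightarrow> 'i \<Rightarrow> 'i \<Rightarrow> 'i \<Rightarrow> 'i \<Rightarrow> real" where
  "tensor_transform M N P Q X a b c d =
     (\<Sum>A\<in>UNIV. M a A * (\<Sum>B\<in>UNIV. N b B * (\<Sum>C\<in>UNIV. P c C * (\<Sum>D\<in>UNIV. Q d D * X A B C D))))"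

text \<open>After the sums are exchanged, the coefficient of \<open>T A B C D\<close> is the
  determinant of the columns A, B, C, D of \<open>F\<close>, that is, the symbol of A, B, C, D times
  \<open>det F\<close>.\<close>

lemma levi_civita_transform:
  fixes F :: "real^4^4"
  defines "f \<equiv> \<lambda>a A. F $ a $ A"
  shows "(\<Sum>a\<in>UNIV. \<Sum>b\<in>UNIV. \<Sum>c\<in>UNIV. \<Sum>d\<in>UNIV.
            levi_civita_symbol a b c d * tensor_transform f f f f T a b c d)
       = det F * (\<Sum>a\<in>UNIV. \<Sum>b\<in>UNIV. \<Sum>c\<in>UNIV. \<Sum>d\<in>UNIV. levi_civita_symbol a b c d * T a b c d)"
proof -
  have prod: "(\<Sum>a\<in>UNIV. \<Sum>b\<in>UNIV. \<Sum>c\<in>UNIV. \<Sum>d\<in>UNIV. Z a b c d)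
      = (\<Sum>(a, b, c, d)\<in>UNIV. Z a b c d)" for Z :: "4 \<Rightarrow> 4 \<Rightarrow> 4 \<Rightarrow> 4 \<Rightarrow> real"
    by (simp add: sum.cartesian_product)
  have transform: "tensor_transform f f f f T a b c d
      = (\<Sum>(A, B, C, D)\<in>UNIV. T A B C D * (f a A * (f b B * (f c C * f d D))))" for a b c d
    by (simp add: tensor_transform_def sum_distrib_left flip: prod) (simp add: algebra_simps)
  have "(\<Sum>a\<in>UNIV. \<Sum>b\<in>UNIV. \<Sum>c\<in>UNIV. \<Sum>d\<in>UNIV.
            levi_civita_symbol a b c d * tensor_transform f f f f T a b c d)
      = (\<Sum>(a, b, c, d)\<in>UNIV. \<Sum>(A, B, C, D)\<in>UNIV. T A B C D *
           (levi_civita_symbol a b c d * (f a A * (f b B * (f c C * f d D)))))"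
    by (simp add: prod transform sum_distrib_left split_def mult.left_commute)
  also have "\<dots> = (\<Sum>(A, B, C, D)\<in>UNIV. T A B C D * (\<Sum>(a, b, c, d)\<in>UNIV.
           levi_civita_symbol a b c d * (f a A * (f b B * (f c C * f d D)))))"
    unfolding split_def sum_distrib_left by (rule sum.swap)
  also have "\<dots> = (\<Sum>(A, B, C, D)\<in>UNIV. T A B C D *
       det (vector [column A F, column B F, column C F, column D F]))"
    by (simp add: f_def column_def flip: prod levi_civita_sum_prod)
  also have "\<dots> = (\<Sum>(A, B, C, D)\<in>UNIV. T A B C D * (levi_civita_symbol A B C D * det F))"
  proof -
    have "(\<chi> i. column i F) = transpose F" by (simp add: column_def transpose_def)
    then show ?thesis by (simp add: det_selected_rows[of "\<lambda>i. column i F"])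
  qed
  finally show ?thesis
    by (simp add: prod sum_distrib_left split_def algebra_simps)
qed

text \<open>Raising or lowering an index changes only the matrix of its slot. Applied to a coframe
  or frame, this produces the dual matrix times a diagonal factor, which
  \<open>transform_scale\<close> moves into the components.\<close>

lemma transform_contract:
  fixes G :: "'i::finite \<Rightarrow> 'i \<Rightarrow> real" and M N P Q :: "'i \<Rightarrow> 'j::finite \<Rightarrow> real"
  shows "(\<Sum>p\<in>UNIV. G a p * tensor_transform M N P Q X p b c d)
        = tensor_transform (\<lambda>a A. \<Sum>p\<in>UNIV. G a p * M p A) N P Q X a b c d"
    and "(\<Sum>p\<in>UNIV. G b p * tensor_transform M N P Q X a p c d)
        = tensor_transform M (\<lambda>a A. \<Sum>p\<in>UNIV. G a p * N p A) P Q X a b c d"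
    and "(\<Sum>p\<in>UNIV. G c p * tensor_transform M N P Q X a b p d)
        = tensor_transform M N (\<lambda>a A. \<Sum>p\<in>UNIV. G a p * P p A) Q X a b c d"
    and "(\<Sum>p\<in>UNIV. G d p * tensor_transform M N P Q X a b c p)
        = tensor_transform M N P (\<lambda>a A. \<Sum>p\<in>UNIV. G a p * Q p A) X a b c d"
proof -
  have 1: "(\<Sum>p\<in>UNIV. G a p * (\<Sum>A\<in>UNIV. K p A * Z A)) = (\<Sum>A\<in>UNIV. (\<Sum>p\<in>UNIV. G a p * K p A) * Z A)"
    for K :: "'i \<Rightarrow> 'j \<Rightarrow> real" and a Z
    unfolding sum_distrib_left sum_distrib_right by (subst sum.swap) (simp add: mult.assoc)
  have 2: "(\<Sum>p\<in>UNIV. G a p * (\<Sum>A\<in>UNIV. k A * Z p A)) = (\<Sum>A\<in>UNIV. k A * (\<Sum>p\<in>UNIV. G a p * Z p A))"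
    for k :: "'j \<Rightarrow> real" and a Z
    unfolding sum_distrib_left by (subst sum.swap) (simp add: mult.left_commute)
  show "(\<Sum>p\<in>UNIV. G a p * tensor_transform M N P Q X p b c d)
        = tensor_transform (\<lambda>a A. \<Sum>p\<in>UNIV. G a p * M p A) N P Q X a b c d"
    unfolding tensor_transform_def by (rule 1)
  show "(\<Sum>p\<in>UNIV. G b p * tensor_transform M N P Q X a p c d)
        = tensor_transform M (\<lambda>a A. \<Sum>p\<in>UNIV. G a p * N p A) P Q X a b c d"
    unfolding tensor_transform_def by (simp only: 2 1)
  show "(\<Sum>p\<in>UNIV. G c p * tensor_transform M N P Q X a b p d)
        = tensor_transform M N (\<lambda>a A. \<Sum>p\<in>UNIV. G a p * P p A) Q X a b c d"
    unfolding tensor_transform_def by (simp only: 2 1)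
  show "(\<Sum>p\<in>UNIV. G d p * tensor_transform M N P Q X a b c p)
        = tensor_transform M N P (\<lambda>a A. \<Sum>p\<in>UNIV. G a p * Q p A) X a b c d"
    unfolding tensor_transform_def by (simp only: 2 1)
qed

lemma transform_scale:
  "tensor_transform (\<lambda>a A. M a A * k A) N P Q X = tensor_transform M N P Q (\<lambda>A B C D. k A * X A B C D)"
  "tensor_transform M (\<lambda>a A. N a A * k A) P Q X = tensor_transform M N P Q (\<lambda>A B C D. k B * X A B C D)"
  "tensor_transform M N (\<lambda>a A. P a A * k A) Q X = tensor_transform M N P Q (\<lambda>A B C D. k C * X A B C D)"
  "tensor_transform M N P (\<lambda>a A. Q a A * k A) X = tensor_transform M N P Q (\<lambda>A B C D. k D * X A B C D)"
  by (simp_all add: tensor_transform_def fun_eq_iff sum_distrib_left mult_ac)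

lemma transform_add:
  "tensor_transform M N P Q (\<lambda>A B C D. X A B C D + Y A B C D) a b c d
     = tensor_transform M N P Q X a b c d + tensor_transform M N P Q Y a b c d"
  by (simp add: tensor_transform_def distrib_left sum.distrib)

lemma transform_commute:
  "tensor_transform M N P Q X a b c d = tensor_transform P Q M N (\<lambda>C D A B. X A B C D) c d a b"
proof -
  have swap: "(\<Sum>p\<in>UNIV. g p * (\<Sum>A\<in>UNIV. k A * Z p A)) = (\<Sum>A\<in>UNIV. k A * (\<Sum>p\<in>UNIV. g p * Z p A))"
    for g k :: "'b \<Rightarrow> real" and Z
    unfolding sum_distrib_left by (subst sum.swap) (simp add: mult.left_commute)
  show ?thesis
    unfolding tensor_transform_def
    apply (subst swap[of "N b"])
    apply (subst swap[of "N b" "Q d"])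
    apply (subst swap[of "M a"])
    apply (subst swap[of "M a" "Q d"])
    by (rule refl)
qed

text \<open>\<open>H\<close> and \<open>K\<close> are dual bases, so summing over a coordinate index
  equals summing over the frame index.\<close>

lemma dual_pairing:
  fixes H K :: "'i::finite \<Rightarrow> 'j::finite \<Rightarrow> real"
  assumes "\<And>A B. (\<Sum>i\<in>UNIV. H i A * K i B) = (if A = B then 1 else 0)"
  shows "(\<Sum>i\<in>UNIV. (\<Sum>A\<in>UNIV. H i A * y A) * (\<Sum>B\<in>UNIV. K i B * z B)) = (\<Sum>A\<in>UNIV. y A * z A)"
proof -
  have "(\<Sum>i\<in>UNIV. (\<Sum>A\<in>UNIV. H i A * y A) * (\<Sum>B\<in>UNIV. K i B * z B))
      = (\<Sum>i\<in>UNIV. \<Sum>A\<in>UNIV. \<Sum>B\<in>UNIV. y A * z B * (H i A * K i B))"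
    by (simp add: sum_product mult_ac)
  also have "\<dots> = (\<Sum>A\<in>UNIV. \<Sum>B\<in>UNIV. \<Sum>i\<in>UNIV. y A * z B * (H i A * K i B))"
    by (subst sum.swap, rule sum.cong[OF refl], rule sum.swap)
  also have "\<dots> = (\<Sum>A\<in>UNIV. \<Sum>B\<in>UNIV. y A * z B * (if A = B then 1 else 0))"
    by (simp only: assms flip: sum_distrib_left)
  finally show ?thesis by (simp add: if_distrib cong: if_cong)
qed

text \<open>Once the slots c, d are contracted, the product of the two Weyl factors is again a
  single four-slot transform, in the index order of the Levi-Civita symbol.\<close>

lemma transform_prod:
  "(\<Sum>K\<in>UNIV. P c K * (\<Sum>L\<in>UNIV. Q d L * Y K L)) * (\<Sum>A\<in>UNIV. M a A * (\<Sum>B\<in>UNIV. N b B * X A B))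
    = tensor_transform M N P Q (\<lambda>A B K L. Y K L * X A B) a b c d"
proof -
  define z where "z = (\<Sum>K\<in>UNIV. P c K * (\<Sum>L\<in>UNIV. Q d L * Y K L))"
  have "(\<Sum>K\<in>UNIV. P c K * (\<Sum>L\<in>UNIV. Q d L * (Y K L * t))) = z * t" for t
    by (simp add: z_def sum_distrib_left sum_distrib_right mult_ac)
  then show ?thesis
    unfolding tensor_transform_def z_def[symmetric]
    by (simp only:) (simp add: sum_distrib_left mult_ac)
qed

lemma transform_sum:
  fixes M N P Q :: "'i \<Rightarrow> 'j::finite \<Rightarrow> real"
    and X :: "'k \<Rightarrow> 'k \<Rightarrow> 'j \<Rightarrow> 'j \<Rightarrow> 'j \<Rightarrow> 'j \<Rightarrow> real"
  shows
  "(\<Sum>C\<in>UNIV. \<Sum>D\<in>UNIV. tensor_transform M N P Q (\<lambda>A B K L. X C D A B K L) a b c d)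
    = tensor_transform M N P Q (\<lambda>A B K L. \<Sum>C\<in>UNIV. \<Sum>D\<in>UNIV. X C D A B K L) a b c d"
proof -
  have "(\<Sum>C\<in>UNIV. tensor_transform M N P Q (Y C) a b c d)
    = tensor_transform M N P Q (\<lambda>A B K L. \<Sum>C\<in>UNIV. Y C A B K L) a b c d"
    for Y :: "'k \<Rightarrow> 'j \<Rightarrow> 'j \<Rightarrow> 'j \<Rightarrow> 'j \<Rightarrow> real"
  proof -
    have "(\<Sum>C\<in>UNIV. \<Sum>A\<in>UNIV. m A * Z C A) = (\<Sum>A\<in>UNIV. m A * (\<Sum>C\<in>UNIV. Z C A))"
      for m :: "'j \<Rightarrow> real" and Z :: "'k \<Rightarrow> 'j \<Rightarrow> real"
      unfolding sum_distrib_left by (rule sum.swap)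
    then show ?thesis by (simp only: tensor_transform_def)
  qed
  then show ?thesis by simp
qed

section \<open>Curvature in a moving frame\<close>

text \<open>A coframe \<open>e x $ A $ i\<close> with dual frame \<open>F x $ i $ A\<close>, diagonal frame metric \<open>\<eta>\<close> and connection
  coefficients \<open>w C x $ A $ B\<close> (the coefficient of \<open>e\<^sup>C\<close> in the connection form
  \<open>\<omega>\<^sup>A\<^sub>B\<close>). \<open>Dw\<close> and \<open>D\<eta>\<close> are derivatives along the frame vectors, given as first argument.\<close>

locale moving_frame =
  fixes U :: "(real^4) set" and g :: metric
    and e F :: "real^4 \<Rightarrow> real^4^4"
    and de :: "4 \<Rightarrow> real^4 \<Rightarrow> real^4^4" and dde :: "4 \<Rightarrow> 4 \<Rightarrow> real^4 \<Rightarrow> real^4^4"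
    and \<eta> :: "4 \<Rightarrow> real^4 \<Rightarrow> real" and D\<eta> :: "4 \<Rightarrow> 4 \<Rightarrow> real^4 \<Rightarrow> real"
    and w :: "4 \<Rightarrow> real^4 \<Rightarrow> real^4^4" and Dw :: "4 \<Rightarrow> 4 \<Rightarrow> real^4 \<Rightarrow> real^4^4"
  assumes open_U: "open U"
    and FE: "x \<in> U \<Longrightarrow> F x ** e x = mat 1"
    and de: "x \<in> U \<Longrightarrow> has_mat_partial i e (de i x) x"
    and dde: "x \<in> U \<Longrightarrow> has_mat_partial k (de i) (dde k i x) x"
    and dde_sym: "x \<in> U \<Longrightarrow> dde k i x = dde i k x"
    and dF: "x \<in> U \<Longrightarrow> \<exists>D. has_mat_partial i F D x"
    and metric: "x \<in> U \<Longrightarrow> g x $ i $ j = (\<Sum>A\<in>UNIV. \<eta> A x * (e x $ A $ i * e x $ A $ j))"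
    and \<eta>_nonzero: "x \<in> U \<Longrightarrow> \<eta> A x \<noteq> 0"
    and d\<eta>: "x \<in> U \<Longrightarrow> has_partial i (\<eta> A) (\<Sum>C\<in>UNIV. e x $ C $ i * D\<eta> C A x) x"
    and dw: "x \<in> U \<Longrightarrow> has_mat_partial i (w C) (\<Sum>D\<in>UNIV. e x $ D $ i *\<^sub>R Dw D C x) x"
    and torsion_free: "x \<in> U \<Longrightarrow> de c x $ A $ d - de d x $ A $ c
        = (\<Sum>C\<in>UNIV. \<Sum>D\<in>UNIV. e x $ C $ c * (e x $ D $ d * (w D x $ A $ C - w C x $ A $ D)))"
    and metric_compatible: "x \<in> U \<Longrightarrow>
        \<eta> A x * w C x $ A $ B + \<eta> B x * w C x $ B $ A = (if A = B then D\<eta> C A x else 0)"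
begin

definition W :: "4 \<Rightarrow> real^4 \<Rightarrow> real^4^4" where
  "W i x = (\<Sum>C\<in>UNIV. e x $ C $ i *\<^sub>R w C x)"

text \<open>The operator \<open>d + W\<close> in the frame, transported to coordinates: the entry
  \<open>k\<close>, \<open>j\<close> is the candidate for the Christoffel symbol with upper index
  \<open>k\<close> and lower indices \<open>i\<close>, \<open>j\<close>.\<close>

definition Gam :: "4 \<Rightarrow> real^4 \<Rightarrow> real^4^4" where
  "Gam i x = F x ** (de i x + W i x ** e x)"

text \<open>Frame components of \<open>d\<omega> + \<omega> \<and> \<omega>\<close>. The last sum is
  the contribution of the exterior derivatives of the coframe, rewritten through vanishing
  torsion.\<close>

definition curv :: "4 \<Rightarrow> 4 \<Rightarrow> real^4 \<Rightarrow> real^4^4" where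
  "curv C D x = Dw C D x - Dw D C x + (w C x ** w D x - w D x ** w C x)
     + (\<Sum>E\<in>UNIV. (w D x $ E $ C - w C x $ E $ D) *\<^sub>R w E x)"

lemma EF: "x \<in> U \<Longrightarrow> e x ** F x = mat 1"
  using FE by (simp add: matrix_left_right_inverse)

lemma FE_sum: "x \<in> U \<Longrightarrow> (\<Sum>A\<in>UNIV. F x $ i $ A * e x $ A $ j) = (if i = j then 1 else 0)"
  using FE[of x] by (simp add: matrix_matrix_mult_def mat_def vec_eq_iff)

lemma EF_sum: "x \<in> U \<Longrightarrow> (\<Sum>i\<in>UNIV. e x $ A $ i * F x $ i $ B) = (if A = B then 1 else 0)"
  using EF[of x] by (simp add: matrix_matrix_mult_def mat_def vec_eq_iff)

lemma metric_sym: "x \<in> U \<Longrightarrow> g x $ i $ j = g x $ j $ i"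
  by (simp add: metric mult_ac)

lemma metric_frame: "x \<in> U \<Longrightarrow> (\<Sum>k\<in>UNIV. g x $ i $ k * F x $ k $ B) = e x $ B $ i * \<eta> B x"
proof -
  assume x: "x \<in> U"
  have "(\<Sum>k\<in>UNIV. g x $ i $ k * F x $ k $ B)
      = (\<Sum>A\<in>UNIV. \<eta> A x * e x $ A $ i * (\<Sum>k\<in>UNIV. e x $ A $ k * F x $ k $ B))"
    unfolding metric[OF x] sum_distrib_left sum_distrib_right
    by (subst sum.swap) (simp add: mult_ac)
  then show ?thesis
    by (simp add: EF_sum[OF x] if_distrib cong: if_cong)
qed

lemma inverse_metric_frame:
  assumes x: "x \<in> U"
  shows "inverse_metric g x $ i $ j = (\<Sum>A\<in>UNIV. F x $ i $ A * F x $ j $ A / \<eta> A x)"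
proof -
  define G where "G = (\<chi> i j. \<Sum>A\<in>UNIV. F x $ i $ A * F x $ j $ A / \<eta> A x)"
  have "(\<Sum>k\<in>UNIV. g x $ i $ k * G $ k $ j) = (if i = j then 1 else 0)" for i j
  proof -
    have "(\<Sum>k\<in>UNIV. g x $ i $ k * G $ k $ j)
        = (\<Sum>A\<in>UNIV. (F x $ j $ A / \<eta> A x) * (\<Sum>k\<in>UNIV. g x $ i $ k * F x $ k $ A))"
      unfolding G_def sum_distrib_left sum_distrib_right vec_lambda_beta
      by (subst sum.swap) (simp add: mult_ac)
    also have "\<dots> = (\<Sum>A\<in>UNIV. F x $ j $ A * e x $ A $ i)"
      using \<eta>_nonzero[OF x] by (simp add: metric_frame[OF x])
    finally show ?thesis by (simp add: FE_sum[OF x] eq_commute)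
  qed
  then have 1: "g x ** G = mat 1"
    by (simp add: matrix_matrix_mult_def mat_def vec_eq_iff)
  then have 2: "G ** g x = mat 1"
    by (simp add: matrix_left_right_inverse)
  \<comment> \<open>\<open>matrix_inv\<close> is a choice: \<open>G\<close> witnesses that an
    inverse exists, so the chosen matrix is one, and multiplying by \<open>G\<close> from the left
    then identifies the two.\<close>
  have "g x ** matrix_inv (g x) = mat 1"
    unfolding matrix_inv_def by (rule someI2[of _ G]) (use 1 2 in auto)
  then have "G ** (g x ** matrix_inv (g x)) = G" by simp
  then have "matrix_inv (g x) = G"
    by (simp add: matrix_mul_assoc 2)
  then show ?thesis
    by (simp add: inverse_metric_def G_def)
qed

lemma inverse_metric_metric:
  assumes x: "x \<in> U"
  shows "(\<Sum>l\<in>UNIV. inverse_metric g x $ k $ l * g x $ l $ j) = (if k = j then 1 else 0)"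
proof -
  have "(\<Sum>l\<in>UNIV. inverse_metric g x $ k $ l * g x $ l $ j)
      = (\<Sum>A\<in>UNIV. (F x $ k $ A / \<eta> A x) * (\<Sum>l\<in>UNIV. g x $ j $ l * F x $ l $ A))"
    unfolding inverse_metric_frame[OF x] sum_distrib_left sum_distrib_right
    by (subst sum.swap) (simp add: mult_ac metric_sym[OF x, of _ j])
  then show ?thesis
    using \<eta>_nonzero[OF x] by (simp add: metric_frame[OF x] FE_sum[OF x])
qed

lemma inverse_metric_coframe:
  assumes x: "x \<in> U"
  shows "(\<Sum>l\<in>UNIV. inverse_metric g x $ k $ l * e x $ A $ l) = F x $ k $ A * inverse (\<eta> A x)"
proof -
  have "(\<Sum>l\<in>UNIV. inverse_metric g x $ k $ l * e x $ A $ l)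
      = (\<Sum>B\<in>UNIV. (F x $ k $ B / \<eta> B x) * (\<Sum>l\<in>UNIV. e x $ A $ l * F x $ l $ B))"
    unfolding inverse_metric_frame[OF x] sum_distrib_left sum_distrib_right
    by (subst sum.swap) (simp add: mult_ac)
  then show ?thesis
    by (simp add: EF_sum[OF x] if_distrib divide_inverse cong: if_cong)
qed

section \<open>Identification with the Levi-Civita connection and its curvature\<close>

lemma Gam_sym:
  assumes x: "x \<in> U" shows "Gam i x $ k $ j = Gam j x $ k $ i"
proof -
  have W: "(W i x ** e x) $ A $ j
      = (\<Sum>C\<in>UNIV. \<Sum>D\<in>UNIV. e x $ C $ i * (e x $ D $ j * w C x $ A $ D))" for i j A
    unfolding W_def matrix_matrix_mult_def
    by (simp add: sum_distrib_left sum_distrib_right) (subst sum.swap, simp add: mult_ac)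
  have "(W j x ** e x) $ A $ i
      = (\<Sum>C\<in>UNIV. \<Sum>D\<in>UNIV. e x $ C $ i * (e x $ D $ j * w D x $ A $ C))" for A
    unfolding W by (subst sum.swap) (simp add: mult_ac)
  then have "de i x $ A $ j + (W i x ** e x) $ A $ j = de j x $ A $ i + (W j x ** e x) $ A $ i" for A
    using torsion_free[OF x, of i A j]
    by (simp add: W right_diff_distrib sum_subtractf)
  then show ?thesis
    unfolding Gam_def matrix_matrix_mult_def[of "F x"] by simp
qed

lemma metric_Gam:
  assumes x: "x \<in> U"
  shows "(\<Sum>k\<in>UNIV. g x $ l $ k * Gam i x $ k $ j)
    = (\<Sum>A\<in>UNIV. \<eta> A x * (e x $ A $ l * (de i x $ A $ j + (W i x ** e x) $ A $ j)))"
proof -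
  have "(\<Sum>k\<in>UNIV. g x $ l $ k * Gam i x $ k $ j)
      = (\<Sum>A\<in>UNIV. (de i x $ A $ j + (W i x ** e x) $ A $ j) * (\<Sum>k\<in>UNIV. g x $ l $ k * F x $ k $ A))"
    unfolding Gam_def matrix_matrix_mult_def[of "F x"] sum_distrib_left vec_lambda_beta
    by (subst sum.swap) (simp add: mult_ac)
  then show ?thesis
    unfolding metric_frame[OF x] by (simp add: mult_ac)
qed

text \<open>The symmetric part of the connection, weighted by the frame metric, is exactly the
  derivative of the frame metric. This absorbs the terms in which \<open>\<eta>\<close> is
  differentiated and leaves the coordinate form of metric compatibility.\<close>

lemma metric_partial:
  assumes x: "x \<in> U"
  shows "partial i (\<lambda>y. g y $ l $ j) x
    = (\<Sum>k\<in>UNIV. g x $ l $ k * Gam i x $ k $ j) + (\<Sum>k\<in>UNIV. g x $ j $ k * Gam i x $ k $ l)"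
proof -
  let ?d = "\<lambda>A. \<Sum>C\<in>UNIV. e x $ C $ i * D\<eta> C A x"
  have de': "has_partial i (\<lambda>y. e y $ A $ j) (de i x $ A $ j) x" for A j
    using de[OF x, of i] by (simp add: has_mat_partial_def)
  have "has_partial i (\<lambda>y. \<Sum>A\<in>UNIV. \<eta> A y * (e y $ A $ l * e y $ A $ j))
     (\<Sum>A\<in>UNIV. ?d A * (e x $ A $ l * e x $ A $ j)
        + \<eta> A x * (de i x $ A $ l * e x $ A $ j + e x $ A $ l * de i x $ A $ j)) x"
    by (intro has_partial_sum has_partial_mult d\<eta>[OF x] de')
  then have "partial i (\<lambda>y. g y $ l $ j) x
     = (\<Sum>A\<in>UNIV. ?d A * (e x $ A $ l * e x $ A $ j)
        + \<eta> A x * (de i x $ A $ l * e x $ A $ j + e x $ A $ l * de i x $ A $ j))"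
    using has_partial_cong[OF open_U x, of "\<lambda>y. g y $ l $ j"
        "\<lambda>y. \<Sum>A\<in>UNIV. \<eta> A y * (e y $ A $ l * e y $ A $ j)" i] metric
    by (intro partial_eq) simp
  moreover have "(\<Sum>A\<in>UNIV. ?d A * (e x $ A $ l * e x $ A $ j))
     = (\<Sum>A\<in>UNIV. \<eta> A x * (e x $ A $ l * (W i x ** e x) $ A $ j))
       + (\<Sum>A\<in>UNIV. \<eta> A x * (e x $ A $ j * (W i x ** e x) $ A $ l))"
  proof -
    have compat: "\<eta> A x * W i x $ A $ B + \<eta> B x * W i x $ B $ A = (if A = B then ?d A else 0)" for A B
    proof -
      have "\<eta> A x * W i x $ A $ B + \<eta> B x * W i x $ B $ A
          = (\<Sum>C\<in>UNIV. e x $ C $ i * (\<eta> A x * w C x $ A $ B + \<eta> B x * w C x $ B $ A))"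
        by (simp add: W_def sum_distrib_left distrib_left sum.distrib mult_ac)
      then show ?thesis by (simp add: metric_compatible[OF x])
    qed
    have "(\<Sum>A\<in>UNIV. \<eta> A x * (e x $ A $ l * (W i x ** e x) $ A $ j))
        = (\<Sum>A\<in>UNIV. \<Sum>B\<in>UNIV. \<eta> A x * W i x $ A $ B * (e x $ A $ l * e x $ B $ j))"
      by (simp add: matrix_matrix_mult_def sum_distrib_left mult_ac)
    moreover have "(\<Sum>A\<in>UNIV. \<eta> A x * (e x $ A $ j * (W i x ** e x) $ A $ l))
        = (\<Sum>A\<in>UNIV. \<Sum>B\<in>UNIV. \<eta> B x * W i x $ B $ A * (e x $ A $ l * e x $ B $ j))"
      by (subst sum.swap) (simp add: matrix_matrix_mult_def sum_distrib_left mult_ac)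
    ultimately show ?thesis
      by (simp only: compat flip: sum.distrib distrib_right)
         (simp add: if_distrib[of "\<lambda>z. z * _"] cong: if_cong)
  qed
  ultimately show ?thesis
    unfolding metric_Gam[OF x] by (simp add: sum.distrib distrib_left mult_ac)
qed

text \<open>Uniqueness of the Levi-Civita connection: in the cyclic combination of metric
  derivatives, symmetry of \<open>Gam\<close> cancels all but two equal terms, whose factor 2 meets
  the 1/2 in the definition.\<close>

lemma christoffel_eq_Gam:
  assumes x: "x \<in> U" shows "christoffel g k i j x = Gam i x $ k $ j"
proof -
  have "partial i (\<lambda>y. g y $ l $ j) x + partial j (\<lambda>y. g y $ i $ l) x - partial l (\<lambda>y. g y $ i $ j) x
      = 2 * (\<Sum>k\<in>UNIV. g x $ l $ k * Gam i x $ k $ j)" for l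
    unfolding metric_partial[OF x]
    by (simp add: Gam_sym[OF x, of l] Gam_sym[OF x, of j _ i])
  then have "christoffel g k i j x
      = (\<Sum>l\<in>UNIV. inverse_metric g x $ k $ l * (\<Sum>n\<in>UNIV. g x $ l $ n * Gam i x $ n $ j))"
    unfolding christoffel_def by (simp add: sum_distrib_left mult_ac)
  also have "\<dots> = (\<Sum>n\<in>UNIV. (\<Sum>l\<in>UNIV. inverse_metric g x $ k $ l * g x $ l $ n) * Gam i x $ n $ j)"
    unfolding sum_distrib_left sum_distrib_right by (subst sum.swap) (simp add: mult_ac)
  also have "\<dots> = Gam i x $ k $ j"
    by (simp add: inverse_metric_metric[OF x] if_distrib[of "\<lambda>z. z * _"] cong: if_cong)
  finally show ?thesis .
qed

lemma W_partial:
  assumes x: "x \<in> U"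
  shows "has_mat_partial c (W d) (\<Sum>C\<in>UNIV. de c x $ C $ d *\<^sub>R w C x
     + e x $ C $ d *\<^sub>R (\<Sum>D\<in>UNIV. e x $ D $ c *\<^sub>R Dw D C x)) x"
  using de[OF x, of c] dw[OF x, of c]
  by (auto simp: W_def has_mat_partial_def intro!: has_partial_sum has_partial_mult)

text \<open>Cartan's second structure equation. Gauge covariance removes all derivatives of the
  frame, and the symmetric second derivatives of the coframe cancel.\<close>

lemma riemann_up_matrix:
  assumes x: "x \<in> U"
  shows "riemann_up g a b c d x = (F x ** (\<Sum>C\<in>UNIV. \<Sum>D\<in>UNIV. (e x $ C $ c * e x $ D $ d) *\<^sub>R curv C D x) ** e x) $ a $ b"
proof -
  define dW where "dW = (\<lambda>c d. \<Sum>C\<in>UNIV. de c x $ C $ d *\<^sub>R w C x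
     + e x $ C $ d *\<^sub>R (\<Sum>D\<in>UNIV. e x $ D $ c *\<^sub>R Dw D C x))"
  have Gam: "has_mat_partial c (Gam d)
      ((- (F x ** de c x ** F x)) ** (de d x + W d x ** e x)
        + F x ** (dde c d x + (dW c d ** e x + W d x ** de c x))) x" for c d
  proof -
    obtain D where D: "has_mat_partial c F D x" using dF[OF x] by blast
    have "D = - (F x ** de c x ** F x)"
      by (rule inverse_frame_partial[OF open_U x FE D de[OF x]])
    then show ?thesis
      unfolding Gam_def[abs_def] dW_def
      using D by (intro has_mat_partial_mult has_mat_partial_add dde[OF x] de[OF x] W_partial[OF x]) simp
  qed
  have partial: "partial c (christoffel g a d b) x =
      ((- (F x ** de c x ** F x)) ** (de d x + W d x ** e x)
        + F x ** (dde c d x + (dW c d ** e x + W d x ** de c x))) $ a $ b" for a b c d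
    using Gam[of c d] partial_cong[OF open_U x, of "christoffel g a d b" "\<lambda>y. Gam d y $ a $ b" c]
    by (simp add: has_mat_partial_def partial_eq christoffel_eq_Gam)
  have "riemann_up g a b c d x = (F x ** (dW c d - dW d c + (W c x ** W d x - W d x ** W c x)) ** e x) $ a $ b"
    using arg_cong[OF gauge_curvature[OF FE[OF x], of "de c x" "de d x" "W d x" "dde c d x" "dW c d"
        "W c x" "dW d c"], of "\<lambda>M. M $ a $ b"]
    unfolding riemann_up_def partial christoffel_eq_Gam[OF x] dde_sym[OF x, of d c]
    by (simp add: Gam_def matrix_matrix_mult_def[of "F x ** (de c x + W c x ** e x)"]
        matrix_matrix_mult_def[of "F x ** (de d x + W d x ** e x)"] sum_subtractf)
  \<comment> \<open>Antisymmetrising the derivative of \<open>W\<close> leaves the curl of the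
    coframe next to the derivatives of \<open>w\<close>; \<open>torsion_free\<close> turns that curl
    into the sum over \<open>E\<close> in \<open>curv\<close>.\<close>
  moreover have "dW c d - dW d c + (W c x ** W d x - W d x ** W c x)
      = (\<Sum>C\<in>UNIV. \<Sum>D\<in>UNIV. (e x $ C $ c * e x $ D $ d) *\<^sub>R curv C D x)"
  proof -
    have WW: "W c x ** W d x = (\<Sum>C\<in>UNIV. \<Sum>D\<in>UNIV. (e x $ C $ c * e x $ D $ d) *\<^sub>R (w C x ** w D x))"
      for c d
    proof -
      have sc: "(s *\<^sub>R A) ** (t *\<^sub>R B) = (s * t) *\<^sub>R (A ** B)" for s t and A B :: "real^4^4"
        by (simp add: matrix_matrix_mult_def vec_eq_iff sum_distrib_left mult_ac)
      have sl: "(\<Sum>C\<in>UNIV. A C) ** B = (\<Sum>C\<in>UNIV. A C ** B)" for A :: "4 \<Rightarrow> real^4^4" and B :: "real^4^4"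
        by (simp add: sum_4 matrix_mult_add_left)
      have sr: "B ** (\<Sum>C\<in>UNIV. A C) = (\<Sum>C\<in>UNIV. B ** A C)" for A :: "4 \<Rightarrow> real^4^4" and B :: "real^4^4"
        by (simp add: sum_4 matrix_add_ldistrib)
      show ?thesis unfolding W_def sl unfolding sr sc ..
    qed
    have WW': "W d x ** W c x = (\<Sum>C\<in>UNIV. \<Sum>D\<in>UNIV. (e x $ C $ c * e x $ D $ d) *\<^sub>R (w D x ** w C x))"
      unfolding WW by (subst sum.swap) (simp add: mult.commute)
    have Dw1: "(\<Sum>C\<in>UNIV. e x $ C $ d *\<^sub>R (\<Sum>D\<in>UNIV. e x $ D $ c *\<^sub>R Dw D C x))
       = (\<Sum>C\<in>UNIV. \<Sum>D\<in>UNIV. (e x $ C $ c * e x $ D $ d) *\<^sub>R Dw C D x)"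
      by (subst sum.swap) (simp add: scaleR_sum_right mult.commute)
    have Dw2: "(\<Sum>C\<in>UNIV. e x $ C $ c *\<^sub>R (\<Sum>D\<in>UNIV. e x $ D $ d *\<^sub>R Dw D C x))
       = (\<Sum>C\<in>UNIV. \<Sum>D\<in>UNIV. (e x $ C $ c * e x $ D $ d) *\<^sub>R Dw D C x)"
      by (simp add: scaleR_sum_right)
    have "(\<Sum>E\<in>UNIV. de c x $ E $ d *\<^sub>R w E x) - (\<Sum>E\<in>UNIV. de d x $ E $ c *\<^sub>R w E x)
       = (\<Sum>E\<in>UNIV. (de c x $ E $ d - de d x $ E $ c) *\<^sub>R w E x)"
      by (simp add: scaleR_diff_left sum_subtractf)
    also have "\<dots> = (\<Sum>E\<in>UNIV. \<Sum>C\<in>UNIV. \<Sum>D\<in>UNIV.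
          (e x $ C $ c * e x $ D $ d) *\<^sub>R ((w D x $ E $ C - w C x $ E $ D) *\<^sub>R w E x))"
      unfolding torsion_free[OF x] by (simp add: scaleR_sum_left mult_ac)
    also have "\<dots> = (\<Sum>C\<in>UNIV. \<Sum>D\<in>UNIV. (e x $ C $ c * e x $ D $ d) *\<^sub>R
          (\<Sum>E\<in>UNIV. (w D x $ E $ C - w C x $ E $ D) *\<^sub>R w E x))"
      unfolding scaleR_sum_right
      by (subst sum.swap, rule sum.cong[OF refl], rule sum.swap)
    finally show ?thesis
      unfolding dW_def WW[of c d] WW' sum.distrib Dw1 Dw2 curv_def scaleR_add_right
        scaleR_diff_right sum_subtractf
      by (simp add: algebra_simps)
  qed
  ultimately show ?thesis by simp
qed

lemma riemann_up_frame:
  assumes x: "x \<in> U"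
  shows "riemann_up g a b c d x = tensor_transform (\<lambda>a A. F x $ a $ A) (\<lambda>b B. e x $ B $ b)
     (\<lambda>c C. e x $ C $ c) (\<lambda>d D. e x $ D $ d) (\<lambda>A B C D. curv C D x $ A $ B) a b c d"
  unfolding riemann_up_matrix[OF x] tensor_transform_def
  by (simp add: matrix_matrix_mult_def sum_4 algebra_simps)

end

text \<open>The curvature is split into a constant curvature part of size \<open>lam\<close> and a
  remainder \<open>Wh\<close>, first index raised. The trace is over the first and third index, as
  in \<open>ricci\<close>, so the metric is Einstein and \<open>Wh\<close> turns out to be the Weyl
  tensor.\<close>

locale einstein_frame = moving_frame U g e F de dde \<eta> D\<eta> w Dw
  for U g e F de dde \<eta> D\<eta> w Dw +
  fixes lam :: real and Wh :: "4 \<Rightarrow> 4 \<Rightarrow> 4 \<Rightarrow> 4 \<Rightarrow> real^4 \<Rightarrow> real"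
  assumes curv_eq: "x \<in> U \<Longrightarrow> curv C D x $ A $ B = Wh A B C D x
      + lam * ((if A = C then if B = D then \<eta> B x else 0 else 0)
             - (if A = D then if B = C then \<eta> B x else 0 else 0))"
    and trace_free: "x \<in> U \<Longrightarrow> (\<Sum>A\<in>UNIV. Wh A B A D x) = 0"
begin

abbreviation "ee x \<equiv> (\<lambda>i A. e x $ A $ i)"
abbreviation "ff x \<equiv> (\<lambda>i A. F x $ i $ A)"

lemma ricci_eq:
  assumes x: "x \<in> U" shows "ricci g b d x = 3 * lam * g x $ b $ d"
proof -
  let ?X = "\<lambda>A B C D. curv C D x $ A $ B"
  have swap: "(\<Sum>B\<in>UNIV. k B * (\<Sum>C\<in>UNIV. l C * Z B C)) = (\<Sum>C\<in>UNIV. l C * (\<Sum>B\<in>UNIV. k B * Z B C))"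
    for k l :: "4 \<Rightarrow> real" and Z
    unfolding sum_distrib_left by (subst sum.swap) (simp add: mult.left_commute)
  have pair: "(\<Sum>i\<in>UNIV. \<Sum>A\<in>UNIV. F x $ i $ A * (\<Sum>C\<in>UNIV. e x $ C $ i * Z A C)) = (\<Sum>A\<in>UNIV. Z A A)"
    for Z :: "4 \<Rightarrow> 4 \<Rightarrow> real"
  proof -
    have "(\<Sum>i\<in>UNIV. \<Sum>A\<in>UNIV. F x $ i $ A * (\<Sum>C\<in>UNIV. e x $ C $ i * Z A C))
        = (\<Sum>A\<in>UNIV. \<Sum>C\<in>UNIV. \<Sum>i\<in>UNIV. Z A C * (e x $ C $ i * F x $ i $ A))"
      unfolding sum_distrib_left
      by (subst sum.swap, rule sum.cong[OF refl], subst sum.swap) (simp add: mult_ac)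
    then show ?thesis
      by (simp add: EF_sum[OF x] if_distrib cong: if_cong flip: sum_distrib_left)
  qed
  \<comment> \<open>The coefficient 3 is the dimension 4 from the first delta term minus 1 from the
    second.\<close>
  have trace: "(\<Sum>A\<in>UNIV. ?X A B A D) = (if B = D then 3 * lam * \<eta> B x else 0)" for B D
    by (cases "B = D") (simp_all add: curv_eq[OF x] sum.distrib trace_free[OF x]
        right_diff_distrib sum_subtractf flip: sum_distrib_left)
  have "ricci g b d x = (\<Sum>a\<in>UNIV. \<Sum>A\<in>UNIV. F x $ a $ A * (\<Sum>C\<in>UNIV. e x $ C $ a *
      (\<Sum>B\<in>UNIV. e x $ B $ b * (\<Sum>D\<in>UNIV. e x $ D $ d * ?X A B C D))))"
    unfolding ricci_def riemann_up_frame[OF x] tensor_transform_def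
    by (subst swap) (rule refl)
  also have "\<dots> = (\<Sum>B\<in>UNIV. e x $ B $ b * (\<Sum>D\<in>UNIV. e x $ D $ d * (\<Sum>A\<in>UNIV. ?X A B A D)))"
    unfolding pair unfolding sum_distrib_left
    by (subst sum.swap, rule sum.cong[OF refl], rule sum.swap)
  also have "\<dots> = 3 * lam * g x $ b $ d"
    unfolding trace by (simp add: metric[OF x] sum_distrib_left if_distrib mult_ac cong: if_cong)
  finally show ?thesis .
qed

lemma scalar_curvature_eq:
  assumes x: "x \<in> U" shows "scalar_curvature g x = 12 * lam"
proof -
  have "scalar_curvature g x
      = 3 * lam * (\<Sum>b\<in>UNIV. \<Sum>d\<in>UNIV. inverse_metric g x $ b $ d * g x $ d $ b)"
    unfolding scalar_curvature_def ricci_eq[OF x]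
    by (simp add: sum_distrib_left mult_ac metric_sym[OF x])
  then show ?thesis by (simp add: inverse_metric_metric[OF x])
qed

lemma riemann_eq:
  assumes x: "x \<in> U"
  shows "riemann g a b c d x
    = tensor_transform (ee x) (ee x) (ee x) (ee x) (\<lambda>A B C D. \<eta> A x * Wh A B C D x) a b c d
      + lam * (g x $ a $ c * g x $ b $ d - g x $ a $ d * g x $ b $ c)"
proof -
  have "riemann g a b c d x
    = tensor_transform (ee x) (ee x) (ee x) (ee x) (\<lambda>A B C D. \<eta> A x * curv C D x $ A $ B) a b c d"
    unfolding riemann_def riemann_up_frame[OF x]
      transform_contract(1)[where G = "\<lambda>a e. g x $ a $ e"] metric_frame[OF x] transform_scale ..
  also have "\<dots> = tensor_transform (ee x) (ee x) (ee x) (ee x) (\<lambda>A B C D. \<eta> A x * Wh A B C D x) a b c d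
    + tensor_transform (ee x) (ee x) (ee x) (ee x) (\<lambda>A B C D. \<eta> A x * (lam *
       ((if A = C then if B = D then \<eta> B x else 0 else 0)
             - (if A = D then if B = C then \<eta> B x else 0 else 0)))) a b c d"
    unfolding curv_eq[OF x] distrib_left transform_add ..
  also have "tensor_transform (ee x) (ee x) (ee x) (ee x) (\<lambda>A B C D. \<eta> A x * (lam *
       ((if A = C then if B = D then \<eta> B x else 0 else 0)
             - (if A = D then if B = C then \<eta> B x else 0 else 0)))) a b c d
     = lam * (g x $ a $ c * g x $ b $ d - g x $ a $ d * g x $ b $ c)"
  proof -
    have if_const: "(\<Sum>D\<in>UNIV. if P then f D else 0) = (if P then \<Sum>D\<in>UNIV. f D else 0)"
      for P and f :: "4 \<Rightarrow> real" by simp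
    have gg: "g x $ a $ c * g x $ b $ d = (\<Sum>A\<in>UNIV. \<Sum>B\<in>UNIV. \<eta> A x * (\<eta> B x *
        (e x $ A $ a * (e x $ A $ c * (e x $ B $ b * e x $ B $ d)))))" for a b c d
      unfolding metric[OF x] sum_product by (simp add: mult_ac)
    show ?thesis
      by (simp add: tensor_transform_def right_diff_distrib sum_subtractf if_const
          if_distrib[of "\<lambda>z. _ * z"] cong: if_cong)
        (simp add: gg sum_distrib_left mult_ac)
  qed
  finally show ?thesis .
qed

text \<open>With Ricci tensor \<open>3 * lam * g\<close> and scalar curvature
  \<open>12 * lam\<close>, the coefficients of the metric products add up to
  \<open>lam - 3 * lam + 2 * lam = 0\<close>.\<close>

lemma weyl_eq:
  assumes x: "x \<in> U"
  shows "weyl g a b c d x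
    = tensor_transform (ee x) (ee x) (ee x) (ee x) (\<lambda>A B C D. \<eta> A x * Wh A B C D x) a b c d"
  unfolding weyl_def riemann_eq[OF x] ricci_eq[OF x] scalar_curvature_eq[OF x]
  by (simp add: algebra_simps)

text \<open>Raising the first index undoes its lowering, which cancels the factor for
  \<open>A\<close>; only the factor for \<open>B\<close> survives.\<close>

lemma weyl_up2_eq:
  assumes x: "x \<in> U"
  shows "weyl_up2 g a b c d x
    = tensor_transform (ff x) (ff x) (ee x) (ee x) (\<lambda>A B C D. inverse (\<eta> B x) * Wh A B C D x) a b c d"
proof -
  have "weyl_up2 g a b c d x = (\<Sum>p\<in>UNIV. inverse_metric g x $ a $ p *
     (\<Sum>q\<in>UNIV. inverse_metric g x $ b $ q * weyl g p q c d x))"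
    by (simp add: weyl_up2_def sum_distrib_left mult_ac)
  also have "\<dots> = tensor_transform (ff x) (ff x) (ee x) (ee x)
      (\<lambda>A B C D. inverse (\<eta> A x) * (inverse (\<eta> B x) * (\<eta> A x * Wh A B C D x))) a b c d"
    unfolding weyl_eq[OF x] transform_contract[where G = "\<lambda>a e. inverse_metric g x $ a $ e"]
      inverse_metric_coframe[OF x] transform_scale ..
  also have "(\<lambda>A B C D. inverse (\<eta> A x) * (inverse (\<eta> B x) * (\<eta> A x * Wh A B C D x)))
      = (\<lambda>A B C D. inverse (\<eta> B x) * Wh A B C D x)"
    using \<eta>_nonzero[OF x] by (simp add: fun_eq_iff field_simps)
  finally show ?thesis .
qed

lemma weyl_up4_eq:
  assumes x: "x \<in> U"
  shows "weyl_up4 g a b c d x = tensor_transform (ff x) (ff x) (ff x) (ff x)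
    (\<lambda>A B C D. inverse (\<eta> C x) * (inverse (\<eta> D x) * (inverse (\<eta> B x) * Wh A B C D x))) a b c d"
proof -
  have "weyl_up4 g a b c d x = (\<Sum>p\<in>UNIV. inverse_metric g x $ c $ p *
     (\<Sum>q\<in>UNIV. inverse_metric g x $ d $ q * weyl_up2 g a b p q x))"
    by (simp add: weyl_up4_def sum_distrib_left mult_ac)
  also have "\<dots> = tensor_transform (ff x) (ff x) (ff x) (ff x)
    (\<lambda>A B C D. inverse (\<eta> C x) * (inverse (\<eta> D x) * (inverse (\<eta> B x) * Wh A B C D x))) a b c d"
    unfolding weyl_up2_eq[OF x] transform_contract[where G = "\<lambda>a e. inverse_metric g x $ a $ e"]
      inverse_metric_coframe[OF x] transform_scale ..
  finally show ?thesis .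
qed

text \<open>The volume factor contributes the absolute value of \<open>det (e x)\<close>, the symbol
  contributes \<open>det (F x)\<close>, its inverse up to sign. What remains is the orientation of
  the frame.\<close>

lemma det_metric:
  assumes x: "x \<in> U"
  shows "sqrt \<bar>det (g x)\<bar> * det (F x) = sgn (det (F x)) * sqrt \<bar>\<Prod>A\<in>UNIV. \<eta> A x\<bar>"
proof -
  define N :: "real^4^4" where "N = (\<chi> A B. if A = B then \<eta> A x else 0)"
  have "g x = Finite_Cartesian_Product.transpose (e x) ** (N ** e x)"
    by (simp add: vec_eq_iff metric[OF x] N_def matrix_matrix_mult_def Finite_Cartesian_Product.transpose_def
        if_distrib[of "\<lambda>z. z * _"] if_distrib[of "\<lambda>z. _ * z"] mult_ac cong: if_cong)
  then have g: "det (g x) = (det (e x))\<^sup>2 * (\<Prod>A\<in>UNIV. \<eta> A x)"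
    by (simp add: det_mul power2_eq_square) (simp add: N_def det_diagonal)
  have "det (F x) * det (e x) = 1"
    using arg_cong[OF FE[OF x], of det] by (simp add: det_mul)
  then have "\<bar>det (e x)\<bar> * det (F x) = sgn (det (F x))"
  proof -
    have "det (e x) = inverse (det (F x))"
      using inverse_unique \<open>det (F x) * det (e x) = 1\<close> by metis
    then show ?thesis by (simp add: real_sgn_eq divide_inverse)
  qed
  then show ?thesis
    by (simp add: g abs_mult real_sqrt_mult algebra_simps)
qed

text \<open>No coordinate index survives: in the slots c, d a coframe meets its dual frame, and the
  slots a, b, k, l all carry \<open>F\<close>, so that contraction with the symbol yields
  \<open>det (F x)\<close>, which combines with the volume factor.\<close>

lemma dual_weyl_contraction_eq:
  assumes x: "x \<in> U"
  shows "dual_weyl_contraction g x = 1/2 * sgn (det (F x)) * sqrt \<bar>\<Prod>A\<in>UNIV. \<eta> A x\<bar> *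
    (\<Sum>A\<in>UNIV. \<Sum>B\<in>UNIV. \<Sum>K\<in>UNIV. \<Sum>L\<in>UNIV. levi_civita_symbol A B K L *
      (\<Sum>C\<in>UNIV. \<Sum>D\<in>UNIV. (inverse (\<eta> L x) * Wh K L C D x) *
        (inverse (\<eta> C x) * (inverse (\<eta> D x) * (inverse (\<eta> B x) * Wh A B C D x)))))"
proof -
  let ?Z = "\<lambda>K L C D. inverse (\<eta> L x) * Wh K L C D x"
  let ?V = "\<lambda>A B C D. inverse (\<eta> C x) * (inverse (\<eta> D x) * (inverse (\<eta> B x) * Wh A B C D x))"
  have pair: "(\<Sum>c\<in>UNIV. \<Sum>d\<in>UNIV. tensor_transform (ff x) (ff x) (ee x) (ee x) ?Z k l c d *
      tensor_transform (ff x) (ff x) (ff x) (ff x) ?V a b c d)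
    = tensor_transform (ff x) (ff x) (ff x) (ff x) (\<lambda>A B K L. \<Sum>C\<in>UNIV. \<Sum>D\<in>UNIV. ?Z K L C D * ?V A B C D) a b k l"
    for a b k l
  proof -
    \<comment> \<open>\<open>y\<close> and \<open>z\<close> hide the slots that meet the symbol.
      Only the slots contracted between the two factors stay visible, one dual pairing for
      each.\<close>
    define y where "y = (\<lambda>C D. \<Sum>K\<in>UNIV. F x $ k $ K * (\<Sum>L\<in>UNIV. F x $ l $ L * ?Z K L C D))"
    define z where "z = (\<lambda>C D. \<Sum>A\<in>UNIV. F x $ a $ A * (\<Sum>B\<in>UNIV. F x $ b $ B * ?V A B C D))"
    have "(\<Sum>c\<in>UNIV. \<Sum>d\<in>UNIV. tensor_transform (ff x) (ff x) (ee x) (ee x) ?Z k l c d *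
        tensor_transform (ff x) (ff x) (ff x) (ff x) ?V a b c d)
      = (\<Sum>d\<in>UNIV. \<Sum>c\<in>UNIV.
          (\<Sum>C\<in>UNIV. e x $ C $ c * (\<Sum>D\<in>UNIV. e x $ D $ d * y C D)) *
          (\<Sum>C\<in>UNIV. F x $ c $ C * (\<Sum>D\<in>UNIV. F x $ d $ D * z C D)))"
      unfolding transform_commute[of "ff x" "ff x" "ee x" "ee x" ?Z k l]
        transform_commute[of "ff x" "ff x" "ff x" "ff x" ?V a b] y_def z_def
      unfolding tensor_transform_def by (rule sum.swap)
    also have "\<dots> = (\<Sum>C\<in>UNIV. \<Sum>d\<in>UNIV.
          (\<Sum>D\<in>UNIV. e x $ D $ d * y C D) * (\<Sum>D\<in>UNIV. F x $ d $ D * z C D))"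
      by (subst dual_pairing[OF EF_sum[OF x]]) (rule sum.swap)
    also have "\<dots> = (\<Sum>C\<in>UNIV. \<Sum>D\<in>UNIV. y C D * z C D)"
      by (subst dual_pairing[OF EF_sum[OF x]]) (rule refl)
    also have "\<dots> = (\<Sum>C\<in>UNIV. \<Sum>D\<in>UNIV.
        tensor_transform (ff x) (ff x) (ff x) (ff x) (\<lambda>A B K L. ?Z K L C D * ?V A B C D) a b k l)"
      unfolding y_def z_def
      by (intro sum.cong refl transform_prod[where M = "ff x" and N = "ff x" and P = "ff x" and Q = "ff x"])
    finally show ?thesis unfolding transform_sum .
  qed
  have "dual_weyl_contraction g x = (\<Sum>a\<in>UNIV. \<Sum>b\<in>UNIV. \<Sum>k\<in>UNIV. \<Sum>l\<in>UNIV.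
      1/2 * sqrt \<bar>det (g x)\<bar> * (levi_civita_symbol a b k l *
        (\<Sum>c\<in>UNIV. \<Sum>d\<in>UNIV. weyl_up2 g k l c d x * weyl_up4 g a b c d x)))"
  proof -
    have "(\<Sum>c\<in>UNIV. \<Sum>d\<in>UNIV. dual_weyl g a b c d x * weyl_up4 g a b c d x)
      = (\<Sum>k\<in>UNIV. \<Sum>l\<in>UNIV. 1/2 * sqrt \<bar>det (g x)\<bar> * (levi_civita_symbol a b k l *
        (\<Sum>c\<in>UNIV. \<Sum>d\<in>UNIV. weyl_up2 g k l c d x * weyl_up4 g a b c d x)))" for a b
    proof -
      let ?T = "\<lambda>c d k l. 1/2 * sqrt \<bar>det (g x)\<bar> * (levi_civita_symbol a b k l *
            (weyl_up2 g k l c d x * weyl_up4 g a b c d x))"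
      have rotate: "(\<Sum>d\<in>UNIV. \<Sum>k\<in>UNIV. \<Sum>l\<in>UNIV. Z d k l) = (\<Sum>k\<in>UNIV. \<Sum>l\<in>UNIV. \<Sum>d\<in>UNIV. Z d k l)"
        for Z :: "4 \<Rightarrow> 4 \<Rightarrow> 4 \<Rightarrow> real"
        by (subst sum.swap, rule sum.cong[OF refl], rule sum.swap)
      have "(\<Sum>c\<in>UNIV. \<Sum>d\<in>UNIV. dual_weyl g a b c d x * weyl_up4 g a b c d x)
        = (\<Sum>c\<in>UNIV. \<Sum>d\<in>UNIV. \<Sum>k\<in>UNIV. \<Sum>l\<in>UNIV. ?T c d k l)"
        by (simp add: dual_weyl_def levi_civita_def sum_distrib_left sum_distrib_right mult_ac)
      also have "\<dots> = (\<Sum>k\<in>UNIV. \<Sum>l\<in>UNIV. \<Sum>c\<in>UNIV. \<Sum>d\<in>UNIV. ?T c d k l)"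
        by (rule trans[OF sum.cong[OF refl rotate] rotate])
      finally show ?thesis by (simp add: sum_distrib_left)
    qed
    then show ?thesis unfolding dual_weyl_contraction_def by simp
  qed
  also have "\<dots> = 1/2 * (sqrt \<bar>det (g x)\<bar> * det (F x)) *
     (\<Sum>A\<in>UNIV. \<Sum>B\<in>UNIV. \<Sum>K\<in>UNIV. \<Sum>L\<in>UNIV. levi_civita_symbol A B K L *
      (\<Sum>C\<in>UNIV. \<Sum>D\<in>UNIV. ?Z K L C D * ?V A B C D))"
    unfolding weyl_up2_eq[OF x] weyl_up4_eq[OF x] pair
    by (simp only: levi_civita_transform flip: sum_distrib_left)
  finally show ?thesis
    unfolding det_metric[OF x] by (simp only: mult.assoc)
qed

end

section \<open>The curvature of the Kerr-(anti-)de Sitter metric\<close>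

text \<open>With the arguments used in \<open>N\<close>, entry \<open>C\<close>, \<open>A\<close>,
  \<open>B\<close> is \<open>R^2\<close> times the coefficient of the \<open>C\<close>-th coframe
  element in the connection form with indices \<open>A\<close>, \<open>B\<close>; it solves the
  torsion and compatibility equations of the coframe. The six arguments after \<open>a\<close> enter
  linearly, so the array is differentiated by differentiating them.\<close>

definition connection_array :: "real \<Rightarrow> real \<Rightarrow> real \<Rightarrow> real \<Rightarrow> real \<Rightarrow> real \<Rightarrow> real \<Rightarrow> real^4^4^4" where
  "connection_array a p q p' q' g h = vector [
     vector [vector [0, g - p, a * q, 0],
             vector [g - p, 0, 0, a * p'],
             vector [a * q', 0, 0, - q'],
             vector [0, - (a * p), q', 0]],
     vector [vector [g - p, 0, 0, a * p'],
             vector [0, g - p, a * q, 0],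
             vector [0, - (a * q'), - p, 0],
             vector [a * p, 0, 0, - p]],
     vector [vector [- (a * q), 0, 0, q],
             vector [0, - (a * q), - p', 0],
             vector [0, p, h - a * q, 0],
             vector [q', 0, 0, h - a * q]],
     vector [vector [0, a * p', - q, 0],
             vector [a * p', 0, 0, - p'],
             vector [- q', 0, 0, a * q - h],
             vector [0, p, h - a * q, 0]]]"

text \<open>A type D Weyl tensor depends on one complex scalar, here with real and imaginary parts
  \<open>P\<close> and \<open>Q\<close> up to powers of \<open>R\<close>. The planes 12 and 34 carry
  twice the weight of the four mixed planes, as vanishing trace demands; \<open>X\<close> and
  \<open>Y\<close> stem from the frame metric.\<close>

definition type_D_block :: "real \<Rightarrow> real \<Rightarrow> real \<Rightarrow> real \<Rightarrow> 4 \<Rightarrow> 4 \<Rightarrow> real^4^4" where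
  "type_D_block X Y P Q C D =
    (if C = 1 \<and> D = 2 then
      vector [vector [0, 2 * P * X, 0, 0], vector [2 * P * X, 0, 0, 0],
             vector [0, 0, 0, 2 * Q * X], vector [0, 0, - (2 * Q * X), 0]]
    else if C = 1 \<and> D = 3 then
      vector [vector [0, 0, - (P * Y), 0], vector [0, 0, 0, Q * Y],
             vector [- (P * X), 0, 0, 0], vector [0, - (Q * X), 0, 0]]
    else if C = 1 \<and> D = 4 then
      vector [vector [0, 0, 0, - (P * Y)], vector [0, 0, - (Q * Y), 0],
             vector [0, Q * X, 0, 0], vector [- (P * X), 0, 0, 0]]
    else if C = 2 \<and> D = 3 then
      vector [vector [0, 0, 0, Q * Y], vector [0, 0, - (P * Y), 0],
             vector [0, P * X, 0, 0], vector [Q * X, 0, 0, 0]]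
    else if C = 2 \<and> D = 4 then
      vector [vector [0, 0, - (Q * Y), 0], vector [0, 0, 0, - (P * Y)],
             vector [- (Q * X), 0, 0, 0], vector [0, P * X, 0, 0]]
    else if C = 3 \<and> D = 4 then
      vector [vector [0, - (2 * Q * Y), 0, 0], vector [- (2 * Q * Y), 0, 0, 0],
             vector [0, 0, 0, 2 * P * Y], vector [0, 0, - (2 * P * Y), 0]]
    else 0)"

definition type_D_weyl :: "real \<Rightarrow> real \<Rightarrow> real \<Rightarrow> real \<Rightarrow> 4 \<Rightarrow> 4 \<Rightarrow> real^4^4" where
  "type_D_weyl X Y P Q C D = type_D_block X Y P Q C D - type_D_block X Y P Q D C"

text \<open>\<open>X1\<close>, \<open>Y1\<close> are half the derivatives of \<open>X\<close>, \<open>Y\<close>, and \<open>X2\<close>, \<open>Y2\<close> are the derivatives of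
  those, so that no fractions occur. With \<open>w = c / R\<^sup>2\<close>, the left-hand side is \<open>R\<^sup>4\<close> times the
  curvature; the last sum comes from the commutators of the frame vectors.\<close>

lemma kerr_curvature_polynomial:
  fixes a m l r u :: real
  assumes R: "R = r\<^sup>2 + a\<^sup>2 * u\<^sup>2"
    and X: "X = (1 - l * r\<^sup>2) * (r\<^sup>2 + a\<^sup>2) - 2 * m * r"
    and X1: "X1 = r - 2 * l * r^3 - l * a\<^sup>2 * r - m"
    and X2: "X2 = 1 - 6 * l * r\<^sup>2 - l * a\<^sup>2"
    and Y: "Y = (1 - u\<^sup>2) * (1 + a\<^sup>2 * l * u\<^sup>2)"
    and Y1: "Y1 = a\<^sup>2 * l * u - u - 2 * a\<^sup>2 * l * u^3"
    and Y2: "Y2 = a\<^sup>2 * l - 1 - 6 * a\<^sup>2 * l * u\<^sup>2"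
  defines "c \<equiv> connection_array a (r * X) (a * u * Y) (r * Y) (a * u * X) (X1 * R) (Y1 * R)"
    and "cr \<equiv> connection_array a (X + 2 * r * X1) 0 Y (2 * a * u * X1) (X2 * R + X1 * (2 * r)) (Y1 * (2 * r))"
    and "cu \<equiv> connection_array a 0 (a * Y + 2 * a * u * Y1) (2 * r * Y1) (a * X) (X1 * (2 * a\<^sup>2 * u)) (Y2 * R + Y1 * (2 * a\<^sup>2 * u))"
  defines "Dw \<equiv> \<lambda>D. if D = 2 then X *\<^sub>R (R *\<^sub>R cr - (4 * r) *\<^sub>R c)
      else if D = 3 then Y *\<^sub>R (R *\<^sub>R cu - (4 * a\<^sup>2 * u) *\<^sub>R c) else 0"
    and "W \<equiv> type_D_weyl X Y (m * (r^3 - 3 * r * (a * u)\<^sup>2)) (m * (3 * r\<^sup>2 * (a * u) - (a * u)^3))"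
    and "\<eta> \<equiv> (vector [- X, X, Y, Y] :: real^4)"
  shows "(Dw C $ D - Dw D $ C + (c $ C ** c $ D - c $ D ** c $ C) + (\<Sum>E\<in>UNIV. (c $ D $ E $ C - c $ C $ E $ D) *\<^sub>R c $ E)) $ A $ B
     = W C D $ A $ B + l * R^3 * ((if A = C then if B = D then \<eta> $ B else 0 else 0)
             - (if A = D then if B = C then \<eta> $ B else 0 else 0))"
proof -
  define lhs where "lhs = (\<lambda>C D A B. (Dw C $ D - Dw D $ C + (c $ C ** c $ D - c $ D ** c $ C)
     + (\<Sum>E\<in>UNIV. (c $ D $ E $ C - c $ C $ E $ D) *\<^sub>R c $ E)) $ A $ B)"
  define rhs where "rhs = (\<lambda>C D A B. W C D $ A $ B + l * R^3 *
     ((if A = C then if B = D then \<eta> $ B else 0 else 0) - (if A = D then if B = C then \<eta> $ B else 0 else 0)))"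
  note components = lhs_def rhs_def Dw_def W_def \<eta>_def c_def cr_def cu_def type_D_weyl_def
    type_D_block_def matrix_matrix_mult_def sum_4 connection_array_def vector_4 Let_def
  note polynomials = R X Y X1 X2 Y1 Y2
  \<comment> \<open>Both sides are antisymmetric in \<open>C\<close> and \<open>D\<close>, which
    leaves six pairs with sixteen entries each.\<close>
  have lhs_swap: "lhs D C A B = - lhs C D A B" for A B C D
    by (simp add: lhs_def sum_4 algebra_simps)
  have W_swap: "W D C = - W C D" for C D
    by (simp add: W_def type_D_weyl_def)
  have rhs_swap: "rhs D C A B = - rhs C D A B" for A B C D
    by (simp add: rhs_def W_swap[of C D] algebra_simps)
  have diag: "lhs C C A B = rhs C C A B" for A B C
    using lhs_swap[of C C A B] rhs_swap[of C C A B] by simp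
  have 12: "\<forall>A B. lhs 1 2 A B = rhs 1 2 A B"
    \<comment> \<open>The abbreviations \<open>R\<close>, \<open>X\<close>, \<open>Y\<close> and
      their derivatives stay atomic while the arrays are evaluated; only then are they expanded,
      leaving polynomial identities in \<open>a\<close>, \<open>m\<close>, \<open>l\<close>,
      \<open>r\<close>, \<open>u\<close>.\<close>
    unfolding forall_4 by (intro conjI; simp add: components; unfold polynomials; algebra)
  have 13: "\<forall>A B. lhs 1 3 A B = rhs 1 3 A B"
    unfolding forall_4 by (intro conjI; simp add: components; unfold polynomials; algebra)
  have 14: "\<forall>A B. lhs 1 4 A B = rhs 1 4 A B"
    unfolding forall_4 by (intro conjI; simp add: components; unfold polynomials; algebra)
  have 23: "\<forall>A B. lhs 2 3 A B = rhs 2 3 A B"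
    unfolding forall_4 by (intro conjI; simp add: components; unfold polynomials; algebra)
  have 24: "\<forall>A B. lhs 2 4 A B = rhs 2 4 A B"
    unfolding forall_4 by (intro conjI; simp add: components; unfold polynomials; algebra)
  have 34: "\<forall>A B. lhs 3 4 A B = rhs 3 4 A B"
    unfolding forall_4 by (intro conjI; simp add: components; unfold polynomials; algebra)
  have swap: "\<forall>A B. lhs D C A B = rhs D C A B" if "\<forall>A B. lhs C D A B = rhs C D A B" for C D
    using that by (simp add: lhs_swap[where C = C and D = D] rhs_swap[where C = C and D = D])
  have diag': "\<forall>A B. lhs C C A B = rhs C C A B" for C
    using diag by blast
  have "\<forall>C D. \<forall>A B. lhs C D A B = rhs C D A B"
    unfolding forall_4[where P = "\<lambda>C. \<forall>D. \<forall>A B. lhs C D A B = rhs C D A B"]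
    unfolding forall_4[where P = "\<lambda>D. \<forall>A B. lhs C D A B = rhs C D A B" for C]
    by (intro conjI diag' 12 13 14 23 24 34 12[THEN swap] 13[THEN swap] 14[THEN swap]
        23[THEN swap] 24[THEN swap] 34[THEN swap])
  then show ?thesis by (simp add: lhs_def rhs_def)
qed

text \<open>All 24 terms have the same sign once multiplied by the symbol. Eight have size
  \<open>4 * k\<close> (planes 12 and 34), sixteen have size \<open>k\<close>, so the total is
  \<open>- 48 * k\<close>.\<close>

lemma type_D_contraction:
  fixes x y P Q :: real
  assumes "x \<noteq> 0" "y \<noteq> 0"
  defines "W \<equiv> \<lambda>A B C D. type_D_weyl x y P Q C D $ A $ B" and "e \<equiv> (vector [- x, x, y, y] :: real^4)"
  shows "(\<Sum>A\<in>UNIV. \<Sum>B\<in>UNIV. \<Sum>K\<in>UNIV. \<Sum>L\<in>UNIV. levi_civita_symbol A B K L *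
      (\<Sum>C\<in>UNIV. \<Sum>D\<in>UNIV. (inverse (e $ L) * W K L C D) *
        (inverse (e $ C) * (inverse (e $ D) * (inverse (e $ B) * W A B C D)))))
     = - 192 * P * Q / (x * y)"
proof -
  define Z where "Z = (\<lambda>A B K L. \<Sum>C\<in>UNIV. \<Sum>D\<in>UNIV. (inverse (e $ L) * W K L C D) *
        (inverse (e $ C) * (inverse (e $ D) * (inverse (e $ B) * W A B C D))))"
  define k where "k = 4 * P * Q / (x * y)"
  have Z:
    "Z 1 2 3 4 = - (4 * k)" "Z 1 2 4 3 = 4 * k" "Z 1 3 2 4 = k" "Z 1 3 4 2 = - k"
    "Z 1 4 2 3 = - k" "Z 1 4 3 2 = k" "Z 2 1 3 4 = 4 * k" "Z 2 1 4 3 = - (4 * k)"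
    "Z 2 3 1 4 = - k" "Z 2 3 4 1 = k" "Z 2 4 1 3 = k" "Z 2 4 3 1 = - k"
    "Z 3 1 2 4 = - k" "Z 3 1 4 2 = k" "Z 3 2 1 4 = k" "Z 3 2 4 1 = - k"
    "Z 3 4 1 2 = - (4 * k)" "Z 3 4 2 1 = 4 * k" "Z 4 1 2 3 = k" "Z 4 1 3 2 = - k"
    "Z 4 2 1 3 = - k" "Z 4 2 3 1 = k" "Z 4 3 1 2 = 4 * k" "Z 4 3 2 1 = - (4 * k)"
    unfolding Z_def sum_4
    by (simp add: W_def e_def type_D_weyl_def type_D_block_def vector_4, simp add: k_def assms field_simps)+
  show ?thesis
    unfolding levi_civita_sum Z[unfolded Z_def] by (simp add: k_def)
qed

section \<open>Coframe, frame and connection of the metric in coordinates\<close>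

locale kerr =
  fixes a m L :: real
  assumes Xi_nonzero: "Xi a L \<noteq> 0"
begin

abbreviation "l \<equiv> L / 3"
definition "R r u = r\<^sup>2 + a\<^sup>2 * u\<^sup>2"
definition "X r = (1 - l * r\<^sup>2) * (r\<^sup>2 + a\<^sup>2) - 2 * m * r"
definition "X1 r = r - 2 * l * r^3 - l * a\<^sup>2 * r - m"
definition "X2 r = 1 - 6 * l * r\<^sup>2 - l * a\<^sup>2"

text \<open>\<open>V = 1 / X\<close> and \<open>S = sin \<theta> / Y\<close> turn derivatives of the coframe into polynomials.\<close>

definition "V r = inverse (X r)"
definition "V1 r = - 2 * X1 r * (V r)\<^sup>2"
definition "V2 r = - 2 * X2 r * (V r)\<^sup>2 - 4 * X1 r * V r * V1 r"
definition "Y u = (1 - u\<^sup>2) * (1 + a\<^sup>2 * l * u\<^sup>2)"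
definition "Y1 u = a\<^sup>2 * l * u - u - 2 * a\<^sup>2 * l * u^3"
definition "Y2 u = a\<^sup>2 * l - 1 - 6 * a\<^sup>2 * l * u\<^sup>2"
definition "T \<theta> = 1 + a\<^sup>2 * l * (cos \<theta>)\<^sup>2"
definition "S \<theta> = inverse (T \<theta> * sin \<theta>)"
definition "S1 \<theta> = - (cos \<theta> * (T \<theta> - 2 * a\<^sup>2 * l * (sin \<theta>)\<^sup>2)) * (S \<theta>)\<^sup>2"
definition "S2 \<theta> = (sin \<theta> * (T \<theta> - 2 * a\<^sup>2 * l * (sin \<theta>)\<^sup>2) + 6 * a\<^sup>2 * l * (cos \<theta>)\<^sup>2 * sin \<theta>) * (S \<theta>)\<^sup>2
   - 2 * (cos \<theta> * (T \<theta> - 2 * a\<^sup>2 * l * (sin \<theta>)\<^sup>2)) * S \<theta> * S1 \<theta>"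

abbreviation "U \<equiv> regular_points a m L"
abbreviation "\<Xi> \<equiv> Xi a L"

lemma Delta_eqs:
  "Delta_r a m L r = X r" "Delta_theta a L \<theta> = T \<theta>" "rho_sq a r \<theta> = R r (cos \<theta>)"
  by (simp_all add: Delta_r_def X_def Delta_theta_def T_def rho_sq_def R_def)

lemma R_sin: "R r (cos \<theta>) = r\<^sup>2 + a\<^sup>2 - a\<^sup>2 * (sin \<theta>)\<^sup>2"
  by (simp add: R_def cos_squared_eq algebra_simps)

lemma in_U: "x \<in> U \<longleftrightarrow> sin (x $ 3) \<noteq> 0 \<and> X (x $ 2) \<noteq> 0 \<and> T (x $ 3) \<noteq> 0 \<and> R (x $ 2) (cos (x $ 3)) \<noteq> 0"
  by (simp add: regular_points_def Delta_eqs)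

lemma Y_cos: "Y (cos \<theta>) = (sin \<theta>)\<^sup>2 * T \<theta>"
  by (simp add: Y_def T_def sin_squared_eq)

lemma open_U: "open U"
proof -
  have "open ({x :: real^4. sin (x $ 3) \<noteq> 0} \<inter> {x. X (x $ 2) \<noteq> 0} \<inter> {x. T (x $ 3) \<noteq> 0} \<inter> {x. R (x $ 2) (cos (x $ 3)) \<noteq> 0})"
    unfolding X_def T_def R_def
    by (intro open_Int open_Collect_neq continuous_intros)
  also have "({x :: real^4. sin (x $ 3) \<noteq> 0} \<inter> {x. X (x $ 2) \<noteq> 0} \<inter> {x. T (x $ 3) \<noteq> 0} \<inter> {x. R (x $ 2) (cos (x $ 3)) \<noteq> 0}) = U"
    using in_U by auto
  finally show ?thesis .
qed

lemma DERIV_XY [THEN DERIV_cong, derivative_intros]: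
  "(X has_real_derivative 2 * X1 r) (at r)"
  "(X1 has_real_derivative X2 r) (at r)"
  "(Y has_real_derivative 2 * Y1 r) (at r)"
  "(Y1 has_real_derivative Y2 r) (at r)"
  unfolding X_def[abs_def] X1_def[abs_def] X2_def Y_def[abs_def] Y1_def[abs_def] Y2_def
  by (auto intro!: derivative_eq_intros simp: power2_eq_square power3_eq_cube field_simps)

lemma DERIV_V [THEN DERIV_cong, derivative_intros]:
  assumes "X r \<noteq> 0"
  shows "(V has_real_derivative V1 r) (at r)" "(V1 has_real_derivative V2 r) (at r)"
proof -
  show V: "(V has_real_derivative V1 r) (at r)"
    unfolding V_def[abs_def] V1_def
    by (rule derivative_eq_intros refl | simp add: assms)+
       (simp add: assms field_simps power2_eq_square)
  show "(V1 has_real_derivative V2 r) (at r)"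
    unfolding V1_def[abs_def]
    by (rule derivative_eq_intros V refl | simp)+
       (simp add: V1_def[symmetric] V2_def power2_eq_square algebra_simps)
qed

lemma DERIV_S [THEN DERIV_cong, derivative_intros]:
  assumes "sin \<theta> \<noteq> 0" "T \<theta> \<noteq> 0"
  shows "(S has_real_derivative S1 \<theta>) (at \<theta>)" "(S1 has_real_derivative S2 \<theta>) (at \<theta>)"
proof -
  have T: "(T has_real_derivative - (2 * a\<^sup>2 * l * cos \<theta> * sin \<theta>)) (at \<theta>)" for \<theta>
    unfolding T_def[abs_def] by (auto intro!: derivative_eq_intros)
  show S: "(S has_real_derivative S1 \<theta>) (at \<theta>)"
    unfolding S_def[abs_def] S1_def
    by (rule derivative_eq_intros T refl | simp add: assms)+
       (simp add: assms field_simps power2_eq_square)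
  show "(S1 has_real_derivative S2 \<theta>) (at \<theta>)"
    unfolding S1_def[abs_def]
    by (rule derivative_eq_intros T S refl | simp)+
       (simp add: S1_def[symmetric] S2_def power2_eq_square algebra_simps)
qed

definition coframe :: "real^4 \<Rightarrow> real^4^4" where
  "coframe x = (let r = x $ 2; \<theta> = x $ 3 in vector [
     vector [1 / \<Xi>, 0, 0, - (a * (sin \<theta>)\<^sup>2 / \<Xi>)],
     vector [0, R r (cos \<theta>) * V r, 0, 0],
     vector [0, 0, - (R r (cos \<theta>) * S \<theta>), 0],
     vector [a / \<Xi>, 0, 0, - ((r\<^sup>2 + a\<^sup>2) / \<Xi>)]])"

definition frame :: "real^4 \<Rightarrow> real^4^4" where
  "frame x = (let r = x $ 2; \<theta> = x $ 3 in vector [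
     vector [\<Xi> * (r\<^sup>2 + a\<^sup>2) / R r (cos \<theta>), 0, 0, - (\<Xi> * a * (sin \<theta>)\<^sup>2 / R r (cos \<theta>))],
     vector [0, X r / R r (cos \<theta>), 0, 0],
     vector [0, 0, - (T \<theta> * sin \<theta> / R r (cos \<theta>)), 0],
     vector [\<Xi> * a / R r (cos \<theta>), 0, 0, - (\<Xi> / R r (cos \<theta>))]])"

definition coframe1 :: "4 \<Rightarrow> real^4 \<Rightarrow> real^4^4" where
  "coframe1 i x = (let r = x $ 2; \<theta> = x $ 3; R = R r (cos \<theta>) in
     if i = 2 then vector [0,
       vector [0, 2 * r * V r + R * V1 r, 0, 0],
       vector [0, 0, - (2 * r * S \<theta>), 0],
       vector [0, 0, 0, - (2 * r / \<Xi>)]]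
     else if i = 3 then vector [
       vector [0, 0, 0, - (2 * a * sin \<theta> * cos \<theta> / \<Xi>)],
       vector [0, - (2 * a\<^sup>2 * cos \<theta> * sin \<theta> * V r), 0, 0],
       vector [0, 0, 2 * a\<^sup>2 * cos \<theta> * sin \<theta> * S \<theta> - R * S1 \<theta>, 0],
       0]
     else 0)"

definition coframe2 :: "4 \<Rightarrow> 4 \<Rightarrow> real^4 \<Rightarrow> real^4^4" where
  "coframe2 k i x = (let r = x $ 2; \<theta> = x $ 3; R = R r (cos \<theta>) in
     if k = 2 \<and> i = 2 then vector [0,
       vector [0, 2 * V r + 4 * r * V1 r + R * V2 r, 0, 0],
       vector [0, 0, - (2 * S \<theta>), 0],
       vector [0, 0, 0, - (2 / \<Xi>)]]
     else if k = 3 \<and> i = 3 then vector [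
       vector [0, 0, 0, - (2 * a * ((cos \<theta>)\<^sup>2 - (sin \<theta>)\<^sup>2) / \<Xi>)],
       vector [0, - (2 * a\<^sup>2 * ((cos \<theta>)\<^sup>2 - (sin \<theta>)\<^sup>2) * V r), 0, 0],
       vector [0, 0, 2 * a\<^sup>2 * ((cos \<theta>)\<^sup>2 - (sin \<theta>)\<^sup>2) * S \<theta>
          + 4 * a\<^sup>2 * cos \<theta> * sin \<theta> * S1 \<theta> - R * S2 \<theta>, 0],
       0]
     else if k = 2 \<and> i = 3 \<or> k = 3 \<and> i = 2 then vector [0,
       vector [0, - (2 * a\<^sup>2 * cos \<theta> * sin \<theta> * V1 r), 0, 0],
       vector [0, 0, - (2 * r * S1 \<theta>), 0],
       0]
     else 0)"

definition eta0 :: "real \<Rightarrow> real \<Rightarrow> real^4" where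
  "eta0 x y = vector [- x, x, y, y]"

definition eta :: "4 \<Rightarrow> real^4 \<Rightarrow> real" where
  "eta A x = eta0 (X (x $ 2)) (Y (cos (x $ 3))) $ A / R (x $ 2) (cos (x $ 3))"

text \<open>The frame vectors are \<open>X / R\<close> times the derivative by \<open>r\<close> for
  index 2 and \<open>Y / R\<close> times the derivative by \<open>u\<close> for index 3; the other
  two differentiate along \<open>t\<close> and \<open>\<phi>\<close> only, on which nothing depends.
  \<open>Dw\<close> has the same shape.\<close>

definition eta1 :: "4 \<Rightarrow> 4 \<Rightarrow> real^4 \<Rightarrow> real" where
  "eta1 C A x = (let r = x $ 2; u = cos (x $ 3); R = R r u in
     if C = 2 then X r / R * ((R * eta0 (2 * X1 r) 0 $ A - 2 * r * eta0 (X r) (Y u) $ A) / R\<^sup>2)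
     else if C = 3 then Y u / R * ((R * eta0 0 (2 * Y1 u) $ A - 2 * a\<^sup>2 * u * eta0 (X r) (Y u) $ A) / R\<^sup>2)
     else 0)"

definition N :: "real \<Rightarrow> real \<Rightarrow> real^4^4^4" where
  "N r u = connection_array a (r * X r) (a * u * Y u) (r * Y u) (a * u * X r) (X1 r * R r u) (Y1 u * R r u)"

definition Nr :: "real \<Rightarrow> real \<Rightarrow> real^4^4^4" where
  "Nr r u = connection_array a (X r + 2 * r * X1 r) 0 (Y u) (2 * a * u * X1 r) (X2 r * R r u + X1 r * (2 * r)) (Y1 u * (2 * r))"

definition Nu :: "real \<Rightarrow> real \<Rightarrow> real^4^4^4" where
  "Nu r u = connection_array a 0 (a * Y u + 2 * a * u * Y1 u) (2 * r * Y1 u) (a * X r) (X1 r * (2 * a\<^sup>2 * u))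
     (Y2 u * R r u + Y1 u * (2 * a\<^sup>2 * u))"

definition w :: "4 \<Rightarrow> real^4 \<Rightarrow> real^4^4" where
  "w C x = (1 / (R (x $ 2) (cos (x $ 3)))\<^sup>2) *\<^sub>R N (x $ 2) (cos (x $ 3)) $ C"

definition Dw :: "4 \<Rightarrow> 4 \<Rightarrow> real^4 \<Rightarrow> real^4^4" where
  "Dw D C x = (let r = x $ 2; u = cos (x $ 3); R = R r u in
     if D = 2 then (X r / R) *\<^sub>R ((1 / R^3) *\<^sub>R (R *\<^sub>R Nr r u - (4 * r) *\<^sub>R N r u) $ C)
     else if D = 3 then (Y u / R) *\<^sub>R ((1 / R^3) *\<^sub>R (R *\<^sub>R Nu r u - (4 * a\<^sup>2 * u) *\<^sub>R N r u) $ C)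
     else 0)"

section \<open>Verification of the frame hypotheses\<close>

lemma FE: "x \<in> U \<Longrightarrow> frame x ** coframe x = mat 1"
  unfolding in_U vec_eq_iff forall_4
  by (simp add: frame_def coframe_def matrix_matrix_mult_def mat_def sum_4 vector_4 Let_def S_def V_def
      Xi_nonzero field_simps) (simp add: R_sin power2_eq_square power4_eq_xxxx algebra_simps)

lemma metric: "x \<in> U \<Longrightarrow> kerr_ads a m L x $ i $ j = (\<Sum>A\<in>UNIV. eta A x * (coframe x $ A $ i * coframe x $ A $ j))"
proof -
  assume x: "x \<in> U"
  have "\<forall>i j. kerr_ads a m L x $ i $ j = (\<Sum>A\<in>UNIV. eta A x * (coframe x $ A $ i * coframe x $ A $ j))"
    using x unfolding in_U forall_4
    by (simp add: kerr_ads_def coframe_def eta_def eta0_def form_t_def form_phi_def sum_4 vector_4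
        Let_def S_def V_def axis_def Xi_nonzero Y_cos Delta_eqs) (simp add: field_simps power2_eq_square, simp flip: add_divide_distrib)
  then show ?thesis by blast
qed

lemma coframe_partial: "x \<in> U \<Longrightarrow> has_mat_partial i coframe (coframe1 i x) x"
proof -
  assume x: "x \<in> U"
  have "\<forall>i A B. has_partial i (\<lambda>y. coframe y $ A $ B) (coframe1 i x $ A $ B) x"
    using x unfolding in_U forall_4 has_partial_def
    by (simp add: coframe_def coframe1_def vector_4 Let_def R_def)
      ((intro conjI)?; (auto intro!: derivative_eq_intros)?; simp add: Xi_nonzero power2_eq_square algebra_simps)
  then show ?thesis by (simp add: has_mat_partial_def)
qed

lemma coframe1_partial: "x \<in> U \<Longrightarrow> has_mat_partial k (coframe1 i) (coframe2 k i x) x"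
proof -
  assume x: "x \<in> U"
  have "\<forall>k i A B. has_partial k (\<lambda>y. coframe1 i y $ A $ B) (coframe2 k i x $ A $ B) x"
    using x unfolding in_U forall_4 has_partial_def
    by (simp add: coframe1_def coframe2_def vector_4 Let_def R_def)
      ((intro conjI)?; (auto intro!: derivative_eq_intros)?; simp add: Xi_nonzero power2_eq_square algebra_simps)
  then show ?thesis by (simp add: has_mat_partial_def)
qed

lemma coframe2_sym: "coframe2 k i x = coframe2 i k x"
  by (cases "k = 2"; cases "i = 2"; cases "k = 3"; cases "i = 3"; simp add: coframe2_def Let_def)

lemma frame_partial: "x \<in> U \<Longrightarrow> \<exists>D. has_mat_partial i frame D x"
proof -
  assume x: "x \<in> U"
  have T: "(T has_real_derivative - (2 * a\<^sup>2 * l * cos \<theta> * sin \<theta>)) (at \<theta>)" for \<theta>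
    unfolding T_def[abs_def] by (auto intro!: derivative_eq_intros)
  note [derivative_intros] = T[THEN DERIV_cong]
  have "\<forall>i A B. \<exists>d. has_partial i (\<lambda>y. frame y $ A $ B) d x"
    using x unfolding in_U forall_4 has_partial_def
    by (simp add: frame_def vector_4 Let_def R_def) (auto intro!: exI derivative_eq_intros)
  then obtain d where "\<And>A B. has_partial i (\<lambda>y. frame y $ A $ B) (d A B) x"
    by metis
  then have "has_mat_partial i frame (\<chi> A B. d A B) x"
    by (simp add: has_mat_partial_def)
  then show ?thesis ..
qed

text \<open>Frame quantities depend on \<open>r\<close> and \<open>cos \<theta>\<close> only, so
  every coordinate derivative reduces to two one-variable derivatives and the chain factor
  \<open>- sin \<theta>\<close>.\<close>

lemma has_partial_r_cos:
  assumes "((\<lambda>r. \<phi> r (cos (x $ 3))) has_real_derivative dr) (at (x $ 2))"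
    and "((\<lambda>u. \<phi> (x $ 2) u) has_real_derivative du) (at (cos (x $ 3)))"
  shows "has_partial i (\<lambda>y. \<phi> (y $ 2) (cos (y $ 3)))
     (if i = 2 then dr else if i = 3 then - sin (x $ 3) * du else 0) x"
proof -
  have "(cos has_real_derivative - sin (x $ 3)) (at (x $ 3))" by (rule DERIV_cos)
  from DERIV_chain2[OF assms(2) this]
  have du: "((\<lambda>\<theta>. \<phi> (x $ 2) (cos \<theta>)) has_real_derivative - sin (x $ 3) * du) (at (x $ 3))"
    by (simp add: mult.commute)
  consider "i = 1" | "i = 2" | "i = 3" | "i = 4" using exhaust_4 by blast
  then show ?thesis
    by cases (use assms(1) du in \<open>simp_all add: has_partial_def\<close>)
qed

text \<open>Converts derivatives along the frame back to coordinate derivatives: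
  \<open>V * X = 1\<close> and \<open>S * Y = sin \<theta>\<close> cancel the
  normalisations.\<close>

lemma coframe_directional:
  assumes x: "x \<in> U"
  defines "R' \<equiv> R (x $ 2) (cos (x $ 3))"
  shows "(\<Sum>C\<in>UNIV. coframe x $ C $ i * (if C = 2 then X (x $ 2) / R' * d2
      else if C = 3 then Y (cos (x $ 3)) / R' * d3 else 0))
    = (if i = 2 then d2 else if i = 3 then - sin (x $ 3) * d3 else 0)"
proof -
  have "V (x $ 2) * X (x $ 2) = 1" "S (x $ 3) * Y (cos (x $ 3)) = sin (x $ 3)" "R' \<noteq> 0"
    using x by (simp_all add: in_U V_def S_def Y_cos power2_eq_square R'_def field_simps)
  then have "coframe x $ 2 $ i * (X (x $ 2) / R' * d2) = (if i = 2 then d2 else 0)"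
    "coframe x $ 3 $ i * (Y (cos (x $ 3)) / R' * d3) = (if i = 3 then - sin (x $ 3) * d3 else 0)"
    using exhaust_4[of i] by (auto simp: coframe_def Let_def vector_4 simp flip: R'_def)
  then show ?thesis by (simp add: sum_4)
qed

lemma DERIV_R:
  "((\<lambda>r. R r u) has_real_derivative 2 * r) (at r)"
  "((\<lambda>u. R r u) has_real_derivative 2 * a\<^sup>2 * u) (at u)"
  unfolding R_def by (auto intro!: derivative_eq_intros)

lemma eta_partial: "x \<in> U \<Longrightarrow> has_partial i (eta A) (\<Sum>C\<in>UNIV. coframe x $ C $ i * eta1 C A x) x"
proof -
  assume x: "x \<in> U"
  define r u where "r = x $ 2" and "u = cos (x $ 3)"
  have nz: "R r u \<noteq> 0" using x by (simp add: in_U r_def u_def)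
  have "\<forall>A. ((\<lambda>r. eta0 (X r) (Y u) $ A) has_real_derivative eta0 (2 * X1 r) 0 $ A) (at r)"
    unfolding forall_4 eta0_def vector_4 by (auto intro!: derivative_eq_intros)
  then have "((\<lambda>r. eta0 (X r) (Y u) $ A / R r u) has_real_derivative
      (R r u * eta0 (2 * X1 r) 0 $ A - 2 * r * eta0 (X r) (Y u) $ A) / (R r u)\<^sup>2) (at r)"
    by (intro DERIV_cong[OF DERIV_divide[OF spec[where x = A] DERIV_R(1) nz]])
       (auto simp: power2_eq_square mult_ac)
  moreover have "\<forall>A. ((\<lambda>u. eta0 (X r) (Y u) $ A) has_real_derivative eta0 0 (2 * Y1 u) $ A) (at u)"
    unfolding forall_4 eta0_def vector_4 by (auto intro!: derivative_eq_intros)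
  then have "((\<lambda>u. eta0 (X r) (Y u) $ A / R r u) has_real_derivative
      (R r u * eta0 0 (2 * Y1 u) $ A - 2 * a\<^sup>2 * u * eta0 (X r) (Y u) $ A) / (R r u)\<^sup>2) (at u)"
    by (intro DERIV_cong[OF DERIV_divide[OF spec[where x = A] DERIV_R(2) nz]])
       (auto simp: power2_eq_square mult_ac)
  ultimately have "has_partial i (eta A)
    (if i = 2 then (R r u * eta0 (2 * X1 r) 0 $ A - 2 * r * eta0 (X r) (Y u) $ A) / (R r u)\<^sup>2
     else if i = 3 then - sin (x $ 3) *
       ((R r u * eta0 0 (2 * Y1 u) $ A - 2 * a\<^sup>2 * u * eta0 (X r) (Y u) $ A) / (R r u)\<^sup>2) else 0) x"
    unfolding eta_def[abs_def] r_def u_def by (intro has_partial_r_cos) auto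
  then show ?thesis
    unfolding coframe_directional[OF x, symmetric] eta1_def Let_def r_def u_def .
qed

lemma connection_array_deriv:
  assumes "(p has_real_derivative p1) (at z)" "(q has_real_derivative q1) (at z)"
    "(p' has_real_derivative p1') (at z)" "(q' has_real_derivative q1') (at z)"
    "(g has_real_derivative g1) (at z)" "(h has_real_derivative h1) (at z)"
  shows "((\<lambda>s. connection_array a (p s) (q s) (p' s) (q' s) (g s) (h s) $ C $ A $ B) has_real_derivative
      connection_array a p1 q1 p1' q1' g1 h1 $ C $ A $ B) (at z)"
proof -
  have "\<forall>C A B. ((\<lambda>s. connection_array a (p s) (q s) (p' s) (q' s) (g s) (h s) $ C $ A $ B) has_real_derivative
      connection_array a p1 q1 p1' q1' g1 h1 $ C $ A $ B) (at z)"
    unfolding forall_4 connection_array_def vector_4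
    by (intro conjI DERIV_const DERIV_cmult DERIV_diff DERIV_minus assms)
  then show ?thesis by blast
qed

lemma w_partial:
  assumes x: "x \<in> U"
  shows "has_mat_partial i (w C) (\<Sum>D\<in>UNIV. coframe x $ D $ i *\<^sub>R Dw D C x) x"
  unfolding has_mat_partial_def
proof (intro allI)
  fix A B
  define r u where "r = x $ 2" and "u = cos (x $ 3)"
  have nz: "R r u \<noteq> 0" using x by (simp add: in_U r_def u_def)
  then have nz2: "(R r u)\<^sup>2 \<noteq> 0" by simp
  have N: "((\<lambda>r. N r u $ C $ A $ B) has_real_derivative Nr r u $ C $ A $ B) (at r)"
      "((\<lambda>u. N r u $ C $ A $ B) has_real_derivative Nu r u $ C $ A $ B) (at u)"
    unfolding N_def Nr_def Nu_def
    by (rule connection_array_deriv; auto intro!: derivative_eq_intros DERIV_R[THEN DERIV_cong] simp: algebra_simps)+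
  have R2: "((\<lambda>r. (R r u)\<^sup>2) has_real_derivative 4 * r * R r u) (at r)"
      "((\<lambda>u. (R r u)\<^sup>2) has_real_derivative 4 * a\<^sup>2 * u * R r u) (at u)"
    by (auto intro!: derivative_eq_intros DERIV_R[THEN DERIV_cong])
  have "((\<lambda>r. N r u $ C $ A $ B / (R r u)\<^sup>2) has_real_derivative
      1 / (R r u)^3 * (R r u * Nr r u $ C $ A $ B - 4 * r * N r u $ C $ A $ B)) (at r)"
    using nz by (intro DERIV_cong[OF DERIV_divide[OF N(1) R2(1) nz2]])
      (simp add: field_simps power2_eq_square power3_eq_cube)
  moreover have "((\<lambda>u. N r u $ C $ A $ B / (R r u)\<^sup>2) has_real_derivative
      1 / (R r u)^3 * (R r u * Nu r u $ C $ A $ B - 4 * a\<^sup>2 * u * N r u $ C $ A $ B)) (at u)"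
    using nz by (intro DERIV_cong[OF DERIV_divide[OF N(2) R2(2) nz2]])
      (simp add: field_simps power2_eq_square power3_eq_cube)
  ultimately have "has_partial i (\<lambda>y. N (y $ 2) (cos (y $ 3)) $ C $ A $ B / (R (y $ 2) (cos (y $ 3)))\<^sup>2)
     (if i = 2 then 1 / (R r u)^3 * (R r u * Nr r u $ C $ A $ B - 4 * r * N r u $ C $ A $ B)
      else if i = 3 then - sin (x $ 3) *
        (1 / (R r u)^3 * (R r u * Nu r u $ C $ A $ B - 4 * a\<^sup>2 * u * N r u $ C $ A $ B)) else 0) x"
    unfolding r_def u_def by (intro has_partial_r_cos) auto
  then have "has_partial i (\<lambda>y. N (y $ 2) (cos (y $ 3)) $ C $ A $ B / (R (y $ 2) (cos (y $ 3)))\<^sup>2)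
     (\<Sum>D\<in>UNIV. coframe x $ D $ i * (if D = 2 then X (x $ 2) / R r u *
          (1 / (R r u)^3 * (R r u * Nr r u $ C $ A $ B - 4 * r * N r u $ C $ A $ B))
        else if D = 3 then Y (cos (x $ 3)) / R r u *
          (1 / (R r u)^3 * (R r u * Nu r u $ C $ A $ B - 4 * a\<^sup>2 * u * N r u $ C $ A $ B)) else 0)) x"
    unfolding coframe_directional[OF x, symmetric] r_def u_def .
  then show "has_partial i (\<lambda>y. w C y $ A $ B) ((\<Sum>D\<in>UNIV. coframe x $ D $ i *\<^sub>R Dw D C x) $ A $ B) x"
    by (simp add: w_def Dw_def Let_def r_def u_def sum_4 mult.assoc)
qed

lemma torsion_free:
  assumes x: "x \<in> U"
  shows "coframe1 c x $ A $ d - coframe1 d x $ A $ c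
     = (\<Sum>C\<in>UNIV. \<Sum>D\<in>UNIV. coframe x $ C $ c * (coframe x $ D $ d * (w D x $ A $ C - w C x $ A $ D)))"
proof -
  define r \<theta> where "r = x $ 2" and "\<theta> = x $ 3"
  define v s y q where "v = V r" and "s = S \<theta>" and "y = Y (cos \<theta>)" and "q = R r (cos \<theta>)"
  have nz: "v \<noteq> 0" "s \<noteq> 0" "q \<noteq> 0" and X: "X r = 1 / v" and y: "y = sin \<theta> / s"
    using x by (simp_all add: in_U v_def V_def s_def S_def y_def Y_cos power2_eq_square r_def \<theta>_def q_def divide_inverse)
  \<comment> \<open>After \<open>X\<close> and \<open>Y\<close> are written through \<open>v\<close>
    and \<open>s\<close>, this is the relation handed to \<open>algebra\<close>.\<close>
  have q: "r\<^sup>2 + a\<^sup>2 = q + a\<^sup>2 * (sin \<theta>)\<^sup>2"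
    by (simp add: q_def R_sin)
  have "\<forall>A c d. coframe1 c x $ A $ d - coframe1 d x $ A $ c
     = (\<Sum>C\<in>UNIV. \<Sum>D\<in>UNIV. coframe x $ C $ c * (coframe x $ D $ d * (w D x $ A $ C - w C x $ A $ D)))"
    unfolding forall_4 sum_4
    by (simp add: coframe_def coframe1_def w_def N_def connection_array_def vector_4 Let_def
          flip: r_def \<theta>_def v_def s_def y_def q_def)
       (simp add: X y nz Xi_nonzero field_simps power2_eq_square, intro conjI; use q in algebra)
  then show ?thesis by blast
qed

lemma metric_compatible:
  assumes x: "x \<in> U"
  shows "eta A x * w C x $ A $ B + eta B x * w C x $ B $ A = (if A = B then eta1 C A x else 0)"
proof -
  have "\<forall>A C B. eta A x * w C x $ A $ B + eta B x * w C x $ B $ A = (if A = B then eta1 C A x else 0)"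
    using x unfolding in_U forall_4
    by (simp add: eta_def eta0_def w_def eta1_def N_def connection_array_def vector_4 Let_def)
      (simp add: field_simps power2_eq_square power3_eq_cube)
  then show ?thesis by blast
qed

subsection \<open>Weyl tensor\<close>

sublocale mf: moving_frame U "kerr_ads a m L" coframe frame coframe1 coframe2 eta eta1 w Dw
proof
  show "open U" by (rule open_U)
next
  fix x A assume "x \<in> U" then show "eta A x \<noteq> 0"
    using exhaust_4[of A] by (auto simp: in_U eta_def eta0_def vector_4 Y_cos)
qed (rule FE coframe_partial coframe1_partial coframe2_sym frame_partial metric eta_partial w_partial
       torsion_free metric_compatible; assumption)+

definition P where "P r u = m * (r^3 - 3 * r * (a * u)\<^sup>2)"
definition Q where "Q r u = m * (3 * r\<^sup>2 * (a * u) - (a * u)^3)"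

definition Wh :: "4 \<Rightarrow> 4 \<Rightarrow> 4 \<Rightarrow> 4 \<Rightarrow> real^4 \<Rightarrow> real" where
  "Wh A B C D x = (let r = x $ 2; u = cos (x $ 3) in
     type_D_weyl (X r) (Y u) (P r u) (Q r u) C D $ A $ B / (R r u)^4)"

lemma curv_eq:
  assumes x: "x \<in> U"
  shows "mf.curv C D x $ A $ B = Wh A B C D x
      + l * ((if A = C then if B = D then eta B x else 0 else 0)
             - (if A = D then if B = C then eta B x else 0 else 0))"
proof -
  define r u where "r = x $ 2" and "u = cos (x $ 3)"
  have nz: "R r u \<noteq> 0" using x by (simp add: in_U r_def u_def)
  define D' where "D' = (\<lambda>D :: 4. if D = 2 then X r *\<^sub>R (R r u *\<^sub>R Nr r u - (4 * r) *\<^sub>R N r u)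
      else if D = 3 then Y u *\<^sub>R (R r u *\<^sub>R Nu r u - (4 * a\<^sup>2 * u) *\<^sub>R N r u) else 0)"
  have Dw: "Dw C D x = (1 / (R r u)^4) *\<^sub>R D' C $ D" for C D
    by (simp add: Dw_def Let_def D'_def power_eq_if mult_ac flip: r_def u_def)
  have w: "w C x = (1 / (R r u)\<^sup>2) *\<^sub>R N r u $ C" for C
    by (simp add: w_def r_def u_def)
  have ww: "w C x ** w D x = (1 / (R r u)^4) *\<^sub>R (N r u $ C ** N r u $ D)" for C D
    unfolding w by (simp add: vec_eq_iff matrix_matrix_mult_def sum_distrib_left power_eq_if mult_ac)
  have wK: "(w D x $ E $ C - w C x $ E $ D) *\<^sub>R w E x
      = (1 / (R r u)^4) *\<^sub>R ((N r u $ D $ E $ C - N r u $ C $ E $ D) *\<^sub>R N r u $ E)" for C D E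
    unfolding w by (simp add: power_eq_if algebra_simps)
  have curv: "mf.curv C D x = (1 / (R r u)^4) *\<^sub>R (D' C $ D - D' D $ C
      + (N r u $ C ** N r u $ D - N r u $ D ** N r u $ C)
      + (\<Sum>E\<in>UNIV. (N r u $ D $ E $ C - N r u $ C $ E $ D) *\<^sub>R N r u $ E))"
    unfolding mf.curv_def Dw ww wK by (simp add: scaleR_sum_right scaleR_add_right scaleR_diff_right)
  have poly: "(D' C $ D - D' D $ C + (N r u $ C ** N r u $ D - N r u $ D ** N r u $ C)
      + (\<Sum>E\<in>UNIV. (N r u $ D $ E $ C - N r u $ C $ E $ D) *\<^sub>R N r u $ E)) $ A $ B
    = type_D_weyl (X r) (Y u) (P r u) (Q r u) C D $ A $ B +
        l * (R r u)^3 * ((if A = C then if B = D then eta0 (X r) (Y u) $ B else 0 else 0)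
             - (if A = D then if B = C then eta0 (X r) (Y u) $ B else 0 else 0))"
    unfolding D'_def N_def Nr_def Nu_def P_def Q_def eta0_def
    by (rule kerr_curvature_polynomial[OF R_def X_def X1_def X2_def Y_def Y1_def Y2_def])
  have "mf.curv C D x $ A $ B = (type_D_weyl (X r) (Y u) (P r u) (Q r u) C D $ A $ B +
        l * (R r u)^3 * ((if A = C then if B = D then eta0 (X r) (Y u) $ B else 0 else 0)
             - (if A = D then if B = C then eta0 (X r) (Y u) $ B else 0 else 0))) / (R r u)^4"
    unfolding curv vector_scaleR_component poly
    by (simp only: real_scaleR_def divide_inverse mult_1_left mult.commute)
  \<comment> \<open>This extra factor turns the \<open>R^3\<close> of the polynomial identity into
    \<open>R^4\<close>, which the common denominator cancels.\<close>
  moreover have "eta0 (X r) (Y u) $ B = eta B x * R r u" for B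
    using nz by (simp add: eta_def r_def u_def)
  ultimately show ?thesis
    using nz by (simp add: Wh_def Let_def add_divide_distrib diff_divide_distrib power_eq_if flip: r_def u_def)
qed

sublocale ef: einstein_frame U "kerr_ads a m L" coframe frame coframe1 coframe2 eta eta1 w Dw l Wh
proof
  fix x :: "real^4" and B D
  have "\<forall>B D. (\<Sum>A\<in>UNIV. Wh A B A D x) = 0"
    unfolding forall_4 by (simp add: Wh_def Let_def type_D_weyl_def type_D_block_def vector_4 sum_4)
  then show "(\<Sum>A\<in>UNIV. Wh A B A D x) = 0" by blast
qed (fact curv_eq)

text \<open>Its sign is what enters the contraction: it must compensate the signs of
  \<open>X\<close> and \<open>Y\<close> lost in the volume factor.\<close>

lemma det_frame:
  assumes x: "x \<in> U"
  shows "det (frame x) = \<Xi>\<^sup>2 * X (x $ 2) * T (x $ 3) * sin (x $ 3) / (R (x $ 2) (cos (x $ 3)))^3"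
proof -
  define r \<theta> where "r = x $ 2" and "\<theta> = x $ 3"
  have nz: "R r (cos \<theta>) \<noteq> 0" using x by (simp add: in_U r_def \<theta>_def)
  have "det (frame x) = \<Xi>\<^sup>2 * X r * T \<theta> * sin \<theta> * (r\<^sup>2 + a\<^sup>2 - a\<^sup>2 * (sin \<theta>)\<^sup>2) / (R r (cos \<theta>))^4"
    by (simp add: det_4 frame_def vector_4 Let_def flip: r_def \<theta>_def)
       (use nz in \<open>simp add: field_simps power_eq_if\<close>)
  then show ?thesis
    unfolding R_sin[symmetric] using nz by (simp add: power_eq_if flip: r_def \<theta>_def)
qed

definition contraction :: "real \<Rightarrow> real \<Rightarrow> real" where
  "contraction r u = 96 * P r u * Q r u / (R r u)^6"

lemma dual_weyl_contraction_kerr: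
  assumes x: "x \<in> U"
  shows "dual_weyl_contraction (kerr_ads a m L) x = - sgn (sin (x $ 3)) * contraction (x $ 2) (cos (x $ 3))"
proof -
  define r \<theta> where "r = x $ 2" and "\<theta> = x $ 3"
  define s t p q xi yi where "s = R r (cos \<theta>)" and "t = T \<theta>" and "p = P r (cos \<theta>)" and "q = Q r (cos \<theta>)"
    and "xi = X r" and "yi = Y (cos \<theta>)"
  have nz: "s \<noteq> 0" "xi \<noteq> 0" "yi \<noteq> 0" "sin \<theta> \<noteq> 0" "t \<noteq> 0"
    using x by (simp_all add: in_U r_def \<theta>_def s_def xi_def yi_def t_def Y_cos)
  have "s \<ge> 0" by (simp add: s_def R_def)
  then have s: "s > 0" using nz by simp
  \<comment> \<open>Every entry is one of \<open>P\<close>, \<open>Q\<close> times one of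
    \<open>X\<close>, \<open>Y\<close>. Splitting \<open>s^4\<close> as \<open>s^3\<close> times
    \<open>s\<close> puts the frame metric itself, \<open>xi / s\<close> and \<open>yi / s\<close>,
    into the place of \<open>X\<close> and \<open>Y\<close>.\<close>
  have scale: "type_D_weyl xi yi p q C D $ A $ B / s^4 = type_D_weyl (xi / s) (yi / s) (p / s^3) (q / s^3) C D $ A $ B"
    for A B C D
  proof -
    have "\<forall>C D A B. type_D_block xi yi p q C D $ A $ B / s^4
        = type_D_block (xi / s) (yi / s) (p / s^3) (q / s^3) C D $ A $ B"
      unfolding forall_4 by (simp add: type_D_block_def vector_4 power_eq_if)
    then show ?thesis by (simp add: type_D_weyl_def diff_divide_distrib)
  qed
  have eta: "eta A x = (vector [- (xi / s), xi / s, yi / s, yi / s] :: real^4) $ A" for A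
    using exhaust_4[of A] by (auto simp: eta_def eta0_def vector_4 simp flip: r_def \<theta>_def s_def xi_def yi_def)
  have sum: "(\<Sum>A\<in>UNIV. \<Sum>B\<in>UNIV. \<Sum>K\<in>UNIV. \<Sum>L\<in>UNIV. levi_civita_symbol A B K L *
      (\<Sum>C\<in>UNIV. \<Sum>D\<in>UNIV. (inverse (eta L x) * Wh K L C D x) *
        (inverse (eta C x) * (inverse (eta D x) * (inverse (eta B x) * Wh A B C D x)))))
     = - 192 * (p / s^3) * (q / s^3) / (xi / s * (yi / s))"
  proof -
    have Wh: "Wh A B C D x = type_D_weyl (xi / s) (yi / s) (p / s^3) (q / s^3) C D $ A $ B" for A B C D
      unfolding scale[symmetric] by (simp add: Wh_def Let_def r_def \<theta>_def s_def p_def q_def xi_def yi_def)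
    show ?thesis
      unfolding eta Wh by (rule type_D_contraction) (simp_all add: nz)
  qed
  have prod: "(\<Prod>A\<in>UNIV. eta A x) = - (xi * yi / s\<^sup>2)\<^sup>2"
    unfolding UNIV_4 by (simp add: eta vector_4 power2_eq_square mult_ac)
  have "(sgn \<Xi>)\<^sup>2 = 1" using Xi_nonzero by (simp add: sgn_if)
  then have det: "sgn (det (frame x)) = sgn xi * sgn t * sgn (sin \<theta>)"
    unfolding det_frame[OF x] using s
    by (simp add: sgn_mult sgn_divide flip: r_def \<theta>_def s_def xi_def t_def)
  have "(sgn (sin \<theta>))\<^sup>2 = 1" using nz by (simp add: sgn_if)
  then have t: "sgn t = sgn yi" unfolding yi_def Y_cos t_def by (simp add: sgn_mult)
  have "sqrt \<bar>\<Prod>A\<in>UNIV. eta A x\<bar> = \<bar>xi\<bar> * \<bar>yi\<bar> / s\<^sup>2"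
    unfolding prod by (simp add: abs_mult)
  then have "sgn (det (frame x)) * sqrt \<bar>\<Prod>A\<in>UNIV. eta A x\<bar>
      = (xi * sgn xi) * (yi * sgn yi) * (sgn xi * sgn yi) * sgn (sin \<theta>) / s\<^sup>2"
    unfolding det t abs_sgn[of xi] abs_sgn[of yi] by (simp add: mult_ac)
  also have "\<dots> = xi * yi * sgn (sin \<theta>) / s\<^sup>2"
  proof -
    have "sgn xi * sgn xi = 1" "sgn yi * sgn yi = 1" using nz by (simp_all add: sgn_if)
    then have "(xi * sgn xi) * (yi * sgn yi) * (sgn xi * sgn yi) * sgn (sin \<theta>) = xi * yi * sgn (sin \<theta>)"
      by algebra
    then show ?thesis by simp
  qed
  finally have "dual_weyl_contraction (kerr_ads a m L) x
      = 1/2 * (xi * yi * sgn (sin \<theta>) / s\<^sup>2) * (- 192 * (p / s^3) * (q / s^3) / (xi / s * (yi / s)))"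
    unfolding ef.dual_weyl_contraction_eq[OF x] sum by (simp only: mult.assoc)
  also have "\<dots> = - sgn (sin \<theta>) * (96 * p * q / s^6)"
    using nz by (simp add: divide_simps power_eq_if)
  finally show ?thesis
    by (simp add: contraction_def r_def \<theta>_def p_def q_def s_def)
qed

subsection \<open>The invariant on the axis\<close>

text \<open>Derivatives of \<open>48 m^2 Im (r - i a u)^(-6)\<close>: the factor 288 is 6 times 48,
  and the two numerators are the imaginary and real parts of \<open>(r + i a u)^7\<close>. At
  \<open>u = 1\<close> the imaginary part is \<open>- a\<close> times the sextic of the
  theorem.\<close>

definition contraction_r where
  "contraction_r r u = - 288 * m\<^sup>2 * (7 * r^6 * (a * u) - 35 * r^4 * (a * u)^3 + 21 * r\<^sup>2 * (a * u)^5 - (a * u)^7) / (R r u)^7"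

definition contraction_u where
  "contraction_u r u = 288 * a * m\<^sup>2 * (r^7 - 21 * r^5 * (a * u)\<^sup>2 + 35 * r^3 * (a * u)^4 - 7 * r * (a * u)^6) / (R r u)^7"

lemma contraction_derivs:
  assumes nz: "R r u \<noteq> 0"
  shows "((\<lambda>r. contraction r u) has_real_derivative contraction_r r u) (at r)"
    and "((\<lambda>u. contraction r u) has_real_derivative contraction_u r u) (at u)"
proof -
  \<comment> \<open>The quotient rule gives denominator \<open>R^12\<close>, of which
    \<open>R^5\<close> cancels.\<close>
  have quotient: "(N' * (R r u)^6 - N * (6 * (D * (R r u)^5))) / ((R r u)^6 * (R r u)^6) = M / (R r u)^7"
    if "N' * R r u - 6 * D * N = M" for N N' D M
    unfolding that[symmetric] using nz by (simp add: divide_simps) (simp add: power_eq_if algebra_simps)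
  have num: "96 * P r u * Q r u = 96 * m\<^sup>2 * (r^3 - 3 * r * (a * u)\<^sup>2) * (3 * r\<^sup>2 * (a * u) - (a * u)^3)" for r u
    by (simp add: P_def Q_def power2_eq_square)
  have nz6: "(R r u)^6 \<noteq> 0" using nz by simp
  have 1: "((\<lambda>r. 96 * P r u * Q r u) has_real_derivative
      96 * m\<^sup>2 * ((3 * r\<^sup>2 - 3 * (a * u)\<^sup>2) * (3 * r\<^sup>2 * (a * u) - (a * u)^3)
        + (r^3 - 3 * r * (a * u)\<^sup>2) * (6 * r * (a * u)))) (at r)"
    unfolding num by (auto intro!: derivative_eq_intros simp: power2_eq_square power3_eq_cube power4_eq_xxxx algebra_simps)
  have 2: "((\<lambda>u. 96 * P r u * Q r u) has_real_derivative
      96 * m\<^sup>2 * (- (6 * r * a * (a * u)) * (3 * r\<^sup>2 * (a * u) - (a * u)^3)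
        + (r^3 - 3 * r * (a * u)\<^sup>2) * (3 * r\<^sup>2 * a - 3 * a * (a * u)\<^sup>2))) (at u)"
    unfolding num by (auto intro!: derivative_eq_intros simp: power2_eq_square power3_eq_cube power4_eq_xxxx algebra_simps)
  have 3: "((\<lambda>r. (R r u)^6) has_real_derivative 6 * ((2 * r) * (R r u)^5)) (at r)"
    "((\<lambda>u. (R r u)^6) has_real_derivative 6 * ((2 * a\<^sup>2 * u) * (R r u)^5)) (at u)"
    by (auto intro!: derivative_eq_intros DERIV_R[THEN DERIV_cong])
  show "((\<lambda>r. contraction r u) has_real_derivative contraction_r r u) (at r)"
    unfolding contraction_def contraction_r_def
    by (rule DERIV_cong[OF DERIV_divide[OF 1 3(1) nz6] quotient]) (unfold num R_def, algebra)
  show "((\<lambda>u. contraction r u) has_real_derivative contraction_u r u) (at u)"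
    unfolding contraction_def contraction_u_def
    by (rule DERIV_cong[OF DERIV_divide[OF 2 3(2) nz6] quotient]) (unfold num R_def, algebra)
qed

lemma covector_l_kerr:
  assumes x: "x \<in> U"
  shows "covector_l (kerr_ads a m L) i x = sgn (sin (x $ 3)) *
     (if i = 2 then contraction_r (x $ 2) (cos (x $ 3))
      else if i = 3 then - sin (x $ 3) * contraction_u (x $ 2) (cos (x $ 3)) else 0)"
proof -
  let ?\<sigma> = "sgn (sin (x $ 3))"
  \<comment> \<open>On this neighbourhood \<open>sin\<close> keeps the sign it has at
    \<open>x\<close>, so the orientation factor is constant and can be taken out of the
    derivative.\<close>
  define V where "V = U \<inter> {y. 0 < sin (y $ 3) * sin (x $ 3)}"
  have nz: "R (x $ 2) (cos (x $ 3)) \<noteq> 0" and s: "sin (x $ 3) \<noteq> 0"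
    using x by (simp_all add: in_U)
  have "open {y :: real^4. 0 < sin (y $ 3) * sin (x $ 3)}"
    by (intro open_Collect_less continuous_intros)
  then have V: "open V" "x \<in> V"
    using open_U x s by (auto simp: V_def zero_less_mult_iff linorder_neq_iff)
  have eq: "dual_weyl_contraction (kerr_ads a m L) y = - ?\<sigma> * contraction (y $ 2) (cos (y $ 3))" if "y \<in> V" for y
  proof -
    have "sgn (sin (y $ 3)) = ?\<sigma>"
      using that by (auto simp: V_def zero_less_mult_iff)
    then show ?thesis using that by (simp add: V_def dual_weyl_contraction_kerr)
  qed
  have "has_partial i (\<lambda>y. - ?\<sigma> * contraction (y $ 2) (cos (y $ 3)))
     (if i = 2 then - ?\<sigma> * contraction_r (x $ 2) (cos (x $ 3))
      else if i = 3 then - sin (x $ 3) * (- ?\<sigma> * contraction_u (x $ 2) (cos (x $ 3))) else 0) x"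
    by (rule has_partial_r_cos[where \<phi> = "\<lambda>r u. - ?\<sigma> * contraction r u"])
       (intro DERIV_cmult contraction_derivs nz)+
  then have "partial i (dual_weyl_contraction (kerr_ads a m L)) x
    = (if i = 2 then - ?\<sigma> * contraction_r (x $ 2) (cos (x $ 3))
      else if i = 3 then - sin (x $ 3) * (- ?\<sigma> * contraction_u (x $ 2) (cos (x $ 3))) else 0)"
    using partial_cong[OF V eq] partial_eq by simp
  then show ?thesis by (simp add: covector_l_def)
qed

text \<open>The inverse metric is diagonal in \<open>r\<close>, \<open>\<theta>\<close>, and the
  orientation sign is squared. The right-hand side stays meaningful on the axis and at roots of
  \<open>X\<close>, which is what the limit exploits.\<close>

lemma I6_kerr:
  assumes x: "x \<in> U"
  shows "I6 (kerr_ads a m L) x = X (x $ 2) / R (x $ 2) (cos (x $ 3)) * (contraction_r (x $ 2) (cos (x $ 3)))\<^sup>2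
     + T (x $ 3) / R (x $ 2) (cos (x $ 3)) * (sin (x $ 3) * contraction_u (x $ 2) (cos (x $ 3)))\<^sup>2"
proof -
  have nz: "R (x $ 2) (cos (x $ 3)) \<noteq> 0" "X (x $ 2) \<noteq> 0" "T (x $ 3) \<noteq> 0" and s: "sin (x $ 3) \<noteq> 0"
    using x by (simp_all add: in_U)
  have inv: "inverse_metric (kerr_ads a m L) x $ 2 $ 2 = X (x $ 2) / R (x $ 2) (cos (x $ 3))"
    "inverse_metric (kerr_ads a m L) x $ 3 $ 3 = T (x $ 3) / R (x $ 2) (cos (x $ 3))"
    "inverse_metric (kerr_ads a m L) x $ 2 $ 3 = 0" "inverse_metric (kerr_ads a m L) x $ 3 $ 2 = 0"
    unfolding mf.inverse_metric_frame[OF x] sum_4 using nz s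
    by (simp_all add: frame_def eta_def eta0_def vector_4 Let_def Y_cos field_simps power2_eq_square)
  have "(sgn (sin (x $ 3)))\<^sup>2 = 1" using s by (simp add: sgn_if)
  then show ?thesis
    unfolding I6_def sum_4 covector_l_kerr[OF x]
    by (simp add: inv power2_eq_square algebra_simps)
qed

text \<open>Regular points must accumulate at the axis point even if \<open>r\<close> is a root of
  \<open>X\<close>. The diagonal path \<open>p\<close> leaves the axis and the root at once, as both
  are isolated along it; on the axis \<open>Delta_theta\<close> equals the nonzero constant
  \<open>Xi\<close>.\<close>

lemma axis_islimpt:
  assumes "r\<^sup>2 + a\<^sup>2 \<noteq> 0"
  shows "(vector [t, r, 0, \<phi>] :: real^4) islimpt U"
proof -
  define p where "p = (\<lambda>s. vector [t, s, s - r, \<phi>] :: real^4)"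
  have lim: "(p \<longlongrightarrow> vector [t, r, 0, \<phi>]) (at r)"
  proof (rule vec_tendstoI)
    fix i :: 4
    have "\<forall>i. ((\<lambda>s. p s $ i) \<longlongrightarrow> vector [t, r, 0, \<phi>] $ i) (at r)"
      unfolding forall_4 p_def vector_4 by (auto intro!: tendsto_eq_intros)
    then show "((\<lambda>s. p s $ i) \<longlongrightarrow> vector [t, r, 0, \<phi>] $ i) (at r)" by blast
  qed
  have "eventually (\<lambda>s. X s \<noteq> 0) (at r)"
  proof -
    define q where "q = [:a\<^sup>2, - 2 * m, 1 - l * a\<^sup>2, 0, - l:]"
    have X: "X s = poly q s" for s
      by (simp add: X_def q_def power2_eq_square algebra_simps)
    \<comment> \<open>If \<open>l = 0\<close> the quadratic coefficient is 1; otherwise the leading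
      coefficient is nonzero.\<close>
    have "q \<noteq> 0" by (auto simp: q_def)
    then have "finite {s. X s = 0}" unfolding X by (rule poly_roots_finite)
    then have "\<not> r islimpt {s. X s = 0}" by (rule islimpt_finite)
    then show ?thesis by (simp add: islimpt_iff_eventually)
  qed
  moreover have "eventually (\<lambda>s. sin (s - r) \<noteq> 0) (at r)"
  proof -
    have "sin d \<noteq> 0" if "d \<noteq> 0" "\<bar>d\<bar> < pi" for d :: real
      using that sin_gt_zero[of d] sin_gt_zero[of "- d"] by (cases "d > 0") auto
    then show ?thesis
      unfolding eventually_at by (intro exI[of _ pi]) (auto simp: dist_real_def)
  qed
  moreover have "eventually (\<lambda>s. T (s - r) \<noteq> 0) (at r)"
  proof (rule tendsto_imp_eventually_ne)
    show "((\<lambda>s. T (s - r)) \<longlongrightarrow> T 0) (at r)"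
      unfolding T_def by (auto intro!: tendsto_eq_intros)
    show "T 0 \<noteq> 0" using Xi_nonzero by (simp add: T_def Xi_def)
  qed
  moreover have "eventually (\<lambda>s. R s (cos (s - r)) \<noteq> 0) (at r)"
  proof (rule tendsto_imp_eventually_ne)
    show "((\<lambda>s. R s (cos (s - r))) \<longlongrightarrow> r\<^sup>2 + a\<^sup>2) (at r)"
      unfolding R_def by (auto intro!: tendsto_eq_intros)
  qed (fact assms)
  ultimately have ev: "eventually (\<lambda>s. p s \<in> U) (at r)"
    by eventually_elim (simp add: in_U p_def vector_4)
  show ?thesis
  proof (rule islimptI)
    fix W assume "vector [t, r, 0, \<phi>] \<in> W" "open (W :: (real^4) set)"
    with lim have "eventually (\<lambda>s. p s \<in> W) (at r)" by (simp add: topological_tendstoD)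
    with ev have "eventually (\<lambda>s. p s \<in> U \<and> p s \<in> W \<and> s \<noteq> r) (at r)"
      using eventually_neq_at_within[of r r UNIV] by eventually_elim simp
    then obtain s where s: "p s \<in> U" "p s \<in> W" "s \<noteq> r"
      using eventually_happens'[of "at r"] by auto
    then have "p s \<noteq> vector [t, r, 0, \<phi>]"
      by (metis p_def vector_4(2))
    with s show "\<exists>y\<in>U. y \<in> W \<and> y \<noteq> vector [t, r, 0, \<phi>]" by blast
  qed
qed

lemma I6_axis:
  assumes nz: "r\<^sup>2 + a\<^sup>2 \<noteq> 0"
  shows "I6_axis_value a m L r
              (- (27648 * m^4 * (a^6 - 21 * a^4 * r\<^sup>2 + 35 * a\<^sup>2 * r^4 - 7 * r^6)\<^sup>2
                   * (L * r^4 + (L * a\<^sup>2 - 3) * r\<^sup>2 + 6 * m * r - 3 * a\<^sup>2) * a\<^sup>2)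
                / (a\<^sup>2 + r\<^sup>2)^15)"
  unfolding I6_axis_value_def value_by_continuity_def
proof (intro allI conjI axis_islimpt nz)
  fix t \<phi>
  let ?x = "vector [t, r, 0, \<phi>] :: real^4"
  define H where "H = (\<lambda>x :: real^4. X (x $ 2) / R (x $ 2) (cos (x $ 3)) * (contraction_r (x $ 2) (cos (x $ 3)))\<^sup>2
     + T (x $ 3) / R (x $ 2) (cos (x $ 3)) * (sin (x $ 3) * contraction_u (x $ 2) (cos (x $ 3)))\<^sup>2)"
  have R0: "R r 1 = a\<^sup>2 + r\<^sup>2" by (simp add: R_def)
  have "(H \<longlongrightarrow> H ?x) (at ?x within U)"
    unfolding H_def X_def T_def contraction_r_def contraction_u_def R_def
    by (intro tendsto_intros) (use nz in \<open>simp_all add: vector_4\<close>)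
  then have lim: "(H \<longlongrightarrow> X r / R r 1 * (contraction_r r 1)\<^sup>2) (at ?x within U)"
    by (simp add: H_def vector_4)
  have "contraction_r r 1 = 288 * m\<^sup>2 * (a * (a^6 - 21 * a^4 * r\<^sup>2 + 35 * a\<^sup>2 * r^4 - 7 * r^6)) / (a\<^sup>2 + r\<^sup>2)^7"
    unfolding contraction_r_def R0 by (simp add: power_eq_if algebra_simps)
  moreover have "X r = - (L * r^4 + (L * a\<^sup>2 - 3) * r\<^sup>2 + 6 * m * r - 3 * a\<^sup>2) / 3"
    by (simp add: X_def power_eq_if field_simps)
  \<comment> \<open>Here \<open>288^2 / 3 = 27648\<close>, and the exponent 15 is 1 from the inverse
    metric plus twice 7.\<close>
  moreover have gen: "- K / 3 / D * (288 * m\<^sup>2 * (a * p) / D^7)\<^sup>2 = - (27648 * m^4 * p\<^sup>2 * K * a\<^sup>2) / D^15"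
    for K D p :: real
    by (simp add: power_divide power_mult_distrib flip: power_Suc)
  ultimately have val: "X r / R r 1 * (contraction_r r 1)\<^sup>2 =
     - (27648 * m^4 * (a^6 - 21 * a^4 * r\<^sup>2 + 35 * a\<^sup>2 * r^4 - 7 * r^6)\<^sup>2
                   * (L * r^4 + (L * a\<^sup>2 - 3) * r\<^sup>2 + 6 * m * r - 3 * a\<^sup>2) * a\<^sup>2)
                / (a\<^sup>2 + r\<^sup>2)^15"
    unfolding R0 by (simp only: gen)
  show "(I6 (kerr_ads a m L) \<longlongrightarrow> - (27648 * m^4 * (a^6 - 21 * a^4 * r\<^sup>2 + 35 * a\<^sup>2 * r^4 - 7 * r^6)\<^sup>2
                   * (L * r^4 + (L * a\<^sup>2 - 3) * r\<^sup>2 + 6 * m * r - 3 * a\<^sup>2) * a\<^sup>2)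
                / (a\<^sup>2 + r\<^sup>2)^15) (at ?x within U)"
  proof (rule Lim_transform_eventually[OF lim[unfolded val]])
    show "eventually (\<lambda>x. H x = I6 (kerr_ads a m L) x) (at ?x within U)"
      by (simp add: eventually_at_filter I6_kerr H_def)
  qed
qed

end

text \<open>With \<open>x = r / a\<close> the sextic is the imaginary part of
  \<open>(x + i)^7\<close> up to sign, so the roots are \<open>cot (k pi / 7)\<close> for k = 3, 2,
  1. The proof uses sign changes around the decimals, and a cubic in the square of \<open>x\<close>
  has no more than three roots. Each error bound is one unit in the last printed digit.\<close>

lemma sextic_roots:
  obtains x1 x2 x3 :: real
  where "x1 < x2" "x2 < x3" "{x. x > 0 \<and> 1 - 21 * x\<^sup>2 + 35 * x^4 - 7 * x^6 = 0} = {x1, x2, x3}"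
    "\<bar>x1 - 0.22824347439\<bar> < 1 / 10^11" "\<bar>x2 - 0.79747338888\<bar> < 1 / 10^11" "\<bar>x3 - 2.0765213965\<bar> < 1 / 10^10"
proof -
  define f where "f = (\<lambda>x :: real. 1 - 21 * x\<^sup>2 + 35 * x^4 - 7 * x^6)"
  have root: "\<exists>x. \<bar>x - c\<bar> < d \<and> f x = 0" if d: "0 < d" and sign: "f (c - d) * f (c + d) < 0" for c d
  proof -
    have cont: "continuous_on {c - d..c + d} f" unfolding f_def by (intro continuous_intros)
    obtain x where x: "c - d \<le> x" "x \<le> c + d" "f x = 0"
      using sign IVT'[of f "c - d" 0 "c + d", OF _ _ _ cont] IVT2'[of f "c + d" 0 "c - d", OF _ _ _ cont] d
      unfolding mult_less_0_iff by force
    moreover have "x \<noteq> c - d" "x \<noteq> c + d" using x sign by auto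
    ultimately show ?thesis by (intro exI[of _ x]) auto
  qed
  obtain x1 where x1: "\<bar>x1 - 0.22824347439\<bar> < 1 / 10^11" "f x1 = 0"
    using root[of "1 / 10^11" "0.22824347439"] by (auto simp: f_def power_divide)
  obtain x2 where x2: "\<bar>x2 - 0.79747338888\<bar> < 1 / 10^11" "f x2 = 0"
    using root[of "1 / 10^11" "0.79747338888"] by (auto simp: f_def power_divide)
  obtain x3 where x3: "\<bar>x3 - 2.0765213965\<bar> < 1 / 10^10" "f x3 = 0"
    using root[of "1 / 10^10" "2.0765213965"] by (auto simp: f_def power_divide)
  have pos: "0 < x1" "x1 < x2" "x2 < x3" using x1(1) x2(1) x3(1) unfolding abs_less_iff by auto
  define q where "q = [:1, - 21, 35, - 7 :: real:]"
  have f: "f x = poly q (x\<^sup>2)" for x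
    by (simp add: f_def q_def power_eq_if algebra_simps)
  have q: "q \<noteq> 0" "degree q = 3" by (simp_all add: q_def)
  have lt: "x1\<^sup>2 < x2\<^sup>2" "x2\<^sup>2 < x3\<^sup>2"
    using pos by (simp_all add: power_strict_mono)
  have "{x1\<^sup>2, x2\<^sup>2, x3\<^sup>2} = {y. poly q y = 0}"
  proof (rule card_seteq)
    show "finite {y. poly q y = 0}" using q(1) by (rule poly_roots_finite)
    show "{x1\<^sup>2, x2\<^sup>2, x3\<^sup>2} \<subseteq> {y. poly q y = 0}" using x1(2) x2(2) x3(2) by (simp add: f)
    have "card {x1\<^sup>2, x2\<^sup>2, x3\<^sup>2} = 3" using lt by simp
    then show "card {y. poly q y = 0} \<le> card {x1\<^sup>2, x2\<^sup>2, x3\<^sup>2}"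
      using card_poly_roots_bound[OF q(1)] q(2) by simp
  qed
  then have "f x = 0 \<longleftrightarrow> x\<^sup>2 \<in> {x1\<^sup>2, x2\<^sup>2, x3\<^sup>2}" for x by (auto simp: f)
  then have "{x. x > 0 \<and> f x = 0} = {x1, x2, x3}"
    using pos by (auto simp: power2_eq_iff_nonneg)
  then show thesis using that[OF pos(2,3) _ x1(1) x2(1) x3(1)] unfolding f_def by blast
qed

theorem corollary24:
  fixes a m \<Lambda> :: real
  assumes "Xi a \<Lambda> \<noteq> 0"
  shows "(\<forall>r. r\<^sup>2 + a\<^sup>2 \<noteq> 0 \<longrightarrow>
            I6_axis_value a m \<Lambda> r
              (- (27648 * m^4 * (a^6 - 21 * a^4 * r\<^sup>2 + 35 * a\<^sup>2 * r^4 - 7 * r^6)\<^sup>2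
                   * (\<Lambda> * r^4 + (\<Lambda> * a\<^sup>2 - 3) * r\<^sup>2 + 6 * m * r - 3 * a\<^sup>2) * a\<^sup>2)
                / (a\<^sup>2 + r\<^sup>2)^15))
       \<and> (\<forall>r. r\<^sup>2 + a\<^sup>2 \<noteq> 0 \<and> Delta_r a m \<Lambda> r = 0 \<longrightarrow> I6_axis_value a m \<Lambda> r 0)
       \<and> (a > 0 \<longrightarrow>
           (\<exists>r1 r2 r3. r1 < r2 \<and> r2 < r3
              \<and> {r. r > 0 \<and> a^6 - 21 * a^4 * r\<^sup>2 + 35 * a\<^sup>2 * r^4 - 7 * r^6 = 0} = {r1, r2, r3}
              \<and> \<bar>r1 - 0.22824347439 * a\<bar> < a / 10^11
              \<and> \<bar>r2 - 0.79747338888 * a\<bar> < a / 10^11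
              \<and> \<bar>r3 - 2.0765213965 * a\<bar> < a / 10^10
              \<and> (\<forall>r\<in>{r1, r2, r3}. I6_axis_value a m \<Lambda> r 0)))"
proof -
  interpret kerr a m \<Lambda> by unfold_locales (rule assms)
  let ?v = "\<lambda>r. - (27648 * m^4 * (a^6 - 21 * a^4 * r\<^sup>2 + 35 * a\<^sup>2 * r^4 - 7 * r^6)\<^sup>2
                   * (\<Lambda> * r^4 + (\<Lambda> * a\<^sup>2 - 3) * r\<^sup>2 + 6 * m * r - 3 * a\<^sup>2) * a\<^sup>2)
                / (a\<^sup>2 + r\<^sup>2)^15"
  have horizon: "I6_axis_value a m \<Lambda> r 0" if "r\<^sup>2 + a\<^sup>2 \<noteq> 0" "Delta_r a m \<Lambda> r = 0" for r
  proof -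
    have "\<Lambda> * r^4 + (\<Lambda> * a\<^sup>2 - 3) * r\<^sup>2 + 6 * m * r - 3 * a\<^sup>2 = - 3 * Delta_r a m \<Lambda> r"
      by (simp add: Delta_r_def power_eq_if field_simps)
    then have "?v r = 0" using that(2) by simp
    then show ?thesis using I6_axis[OF that(1)] by (simp only:)
  qed
  have roots: "\<exists>r1 r2 r3. r1 < r2 \<and> r2 < r3
              \<and> {r. r > 0 \<and> a^6 - 21 * a^4 * r\<^sup>2 + 35 * a\<^sup>2 * r^4 - 7 * r^6 = 0} = {r1, r2, r3}
              \<and> \<bar>r1 - 0.22824347439 * a\<bar> < a / 10^11
              \<and> \<bar>r2 - 0.79747338888 * a\<bar> < a / 10^11
              \<and> \<bar>r3 - 2.0765213965 * a\<bar> < a / 10^10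
              \<and> (\<forall>r\<in>{r1, r2, r3}. I6_axis_value a m \<Lambda> r 0)" if a: "a > 0"
  proof -
    obtain x1 x2 x3 :: real where x: "x1 < x2" "x2 < x3"
        "{x. x > 0 \<and> 1 - 21 * x\<^sup>2 + 35 * x^4 - 7 * x^6 = 0} = {x1, x2, x3}"
      and approx: "\<bar>x1 - 0.22824347439\<bar> < 1 / 10^11" "\<bar>x2 - 0.79747338888\<bar> < 1 / 10^11"
        "\<bar>x3 - 2.0765213965\<bar> < 1 / 10^10"
      by (rule sextic_roots)
    have scale: "\<bar>x * a - c * a\<bar> < a / d" if "\<bar>x - c\<bar> < 1 / d" for x c d
    proof -
      have "\<bar>x * a - c * a\<bar> = \<bar>x - c\<bar> * a" using a by (simp add: abs_mult flip: left_diff_distrib)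
      also have "\<dots> < 1 / d * a" using that a by (intro mult_strict_right_mono)
      finally show ?thesis by simp
    qed
    \<comment> \<open>Homogeneity of degree 6 reduces the roots to the case
      \<open>a = 1\<close>.\<close>
    have homogeneous: "a^6 - 21 * a^4 * r\<^sup>2 + 35 * a\<^sup>2 * r^4 - 7 * r^6
        = a^6 * (1 - 21 * (r / a)\<^sup>2 + 35 * (r / a)^4 - 7 * (r / a)^6)" for r
      using a by (simp add: power_divide field_simps)
    have root_iff: "r > 0 \<and> a^6 - 21 * a^4 * r\<^sup>2 + 35 * a\<^sup>2 * r^4 - 7 * r^6 = 0 \<longleftrightarrow> r / a \<in> {x1, x2, x3}" for r
      unfolding homogeneous x(3)[symmetric] using a by (simp add: zero_less_divide_iff)
    have set: "{r. r > 0 \<and> a^6 - 21 * a^4 * r\<^sup>2 + 35 * a\<^sup>2 * r^4 - 7 * r^6 = 0} = {x1 * a, x2 * a, x3 * a}"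
      unfolding root_iff using a by (auto simp: divide_eq_eq)
    have zero: "I6_axis_value a m \<Lambda> r 0" if "r \<in> {x1 * a, x2 * a, x3 * a}" for r
    proof -
      have r: "a^6 - 21 * a^4 * r\<^sup>2 + 35 * a\<^sup>2 * r^4 - 7 * r^6 = 0"
        using that unfolding set[symmetric] by simp
      have nz: "r\<^sup>2 + a\<^sup>2 \<noteq> 0" using a by (simp add: sum_power2_eq_zero_iff)
      have "?v r = 0" unfolding r by simp
      then show ?thesis using I6_axis[OF nz] by (simp only:)
    qed
    have "x1 * a < x2 * a" "x2 * a < x3 * a" using x(1,2) a by simp_all
    then show ?thesis
      using set zero scale[OF approx(1)] scale[OF approx(2)] scale[OF approx(3)] by blast
  qed
  show ?thesis
    using I6_axis horizon roots by blast
qed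

end
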